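(* Let $G_1$ and $G_2$ be Gorenstein sandpile graphs with absolute sinks. If $G$ is a wiring of $G_1$ into $G_2$, then $G$ is Gorenstein.
   Context: **Graphs.** A directed multigraph $G=(V,E)$ has a finite vertex set $V$ and edge set $E\subseteq V\times V$ with a weight function $\mathrm{wt}:V\times V\to\mathbb{N}$, $\mathrm{wt}(u,v)>0$ iff $(u,v)\in E$ (loops allowed). $\mathrm{outdeg}(v)=\sum_{u\in V}\mathrm{wt}(v,u)$. A sandpile graph $(V,E,s)$ is a directed multigraph with a vertex $s$ (the sink) that is globally accessible: from every vertex there is a directed path to $s$. The sink is absolute if $\mathrm{outdeg}(s)=0$. Write $\widetilde V=V\setminus\{s\}$. The Laplacian is $\Delta_G:\mathbb{Z}V\to\mathbb{Z}V$, $\Delta_G(v)=\mathrm{outdeg}(v)\,v-\sum_{u\in V}\mathrm{wt}(v,u)\,u$. **Gorenstein sandpile graphs.** Let $V=\{v_1,\dots,v_{n+1}\}$ with $v_{n+1}$ the sink and identify $\mathbb{Z}V$ with $\mathbb{Z}^{n+1}$. The homogeneous toppling ideal is $I_h(G)=\mathrm{Span}_{\mathbb{C}}\{x^u-x^v:u,v\in\mathbb{N}^{n+1},\ u-v\in\mathrm{im}(\Delta_G)\}\subseteq S=\mathbb{C}[x_1,\dots,x_{n+1}]$; its zero set $X\subset\mathbb{P}^n$ is finite. An Artinian reduction of $A=S/I_h(G)$ is a ring $A/(a)$ with $a\in S$ a linear form vanishing at no point of $X$. A graded quotient $B$ of $S$ by a homogeneous ideal is called (Artinian) Gorenstein if $\dim_{\mathbb{C}}B<\infty$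 and its socle $\{f\in B: f\mathfrak{m}=0\}$, $\mathfrak{m}=(x_1,\dots,x_{n+1})$, is one-dimensional over $\mathbb{C}$. $G$ is a Gorenstein sandpile graph if $S/I_h(G)$ has a Gorenstein Artinian reduction. **Wirings.** A divisor on $G$ is an element of $\mathbb{Z}V$; divisors are linearly equivalent if their difference is in $\mathrm{im}(\Delta_G)$; $|D|$ is the set of divisors with nonnegative coefficients linearly equivalent to $D$. Let $G_i=(V_i,E_i,s_i)$, $i=1,2$, be vertex-disjoint sandpile graphs with weight functions $\mathrm{wt}_i$ and absolute sinks $s_i$. A wiring of $G_1$ into $G_2$ is a sandpile graph $G$ with vertex set $V_1\sqcup V_2$, absolute sink $s_2$, and weight function $\mathrm{wt}$ such that: $\mathrm{wt}=\mathrm{wt}_1$ on $\widetilde V_1\times V_1$; $\mathrm{wt}=\mathrm{wt}_2$ on $V_2\times V_2$; $\mathrm{wt}(u,v)=0$ for $(u,v)\in(\widetilde V_1\times V_2)\cup(V_2\times V_1)$; $\mathrm{wt}(s_1,v)>0$ for some $v\in V_2$; and the wiring divisor $D=\sum_{v\in V_1}\Delta_G(s_1)_v\,v$, regarded as a divisor on $G_1$, satisfies $|D|\neq\emptyset$. *)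

theory Defs
  imports
    Complex_Main
    "HOL-Library.Poly_Mapping"
    "HOL-Algebra.QuotRing"
    "HOL-Algebra.Embedded_Algebras"
    "HOL-Algebra.Algebraic_Closure_Type"
begin

section \<open>Sandpile graphs\<close>

text \<open>
  The finite vertex set is a finite type \<open>'v\<close>. A directed multigraph is given by its weight
  function \<open>wt\<close>, which determines its edges; \<open>\<int>V\<close> is the type of functions from \<open>'v\<close> to \<open>int\<close>.
\<close>

definition edges :: "('v \<Rightarrow> 'v \<Rightarrow> nat) \<Rightarrow> ('v \<times> 'v) set" where
  "edges wt = {(u, v). wt u v > 0}"

definition sandpile_graph :: "('v::finite \<Rightarrow> 'v \<Rightarrow> nat) \<Rightarrow> 'v \<Rightarrow> bool" where
  "sandpile_graph wt s \<longleftrightarrow> (\<forall>v. (v, s) \<in> (edges wt)\<^sup>*)"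

definition outdeg :: "('v::finite \<Rightarrow> 'v \<Rightarrow> nat) \<Rightarrow> 'v \<Rightarrow> nat" where
  "outdeg wt v = (\<Sum>u\<in>UNIV. wt v u)"

definition absolute_sink :: "('v::finite \<Rightarrow> 'v \<Rightarrow> nat) \<Rightarrow> 'v \<Rightarrow> bool" where
  "absolute_sink wt s \<longleftrightarrow> outdeg wt s = 0"

text \<open>The basis element of \<open>\<int>V\<close> belonging to a vertex.\<close>

definition vertex_divisor :: "'v \<Rightarrow> 'v \<Rightarrow> int" where
  "vertex_divisor v = (\<lambda>w. if w = v then 1 else 0)"

text \<open>
  The \<open>\<int>\<close>-linear extension of \<open>v \<mapsto> outdeg(v) v - (\<Sum>u. wt(v,u) u)\<close>; the result is given by its
  coefficient at each vertex \<open>w\<close>.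
\<close>

definition laplacian :: "('v::finite \<Rightarrow> 'v \<Rightarrow> nat) \<Rightarrow> ('v \<Rightarrow> int) \<Rightarrow> 'v \<Rightarrow> int" where
  "laplacian wt D =
     (\<lambda>w. \<Sum>v\<in>UNIV. D v * (int (outdeg wt v) * vertex_divisor v w - int (wt v w)))"

definition linearly_equivalent :: "('v::finite \<Rightarrow> 'v \<Rightarrow> nat) \<Rightarrow> ('v \<Rightarrow> int) \<Rightarrow> ('v \<Rightarrow> int) \<Rightarrow> bool" where
  "linearly_equivalent wt D D' \<longleftrightarrow> (\<lambda>v. D v - D' v) \<in> range (laplacian wt)"

definition complete_linear_system :: "('v::finite \<Rightarrow> 'v \<Rightarrow> nat) \<Rightarrow> ('v \<Rightarrow> int) \<Rightarrow> ('v \<Rightarrow> int) set" where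
  "complete_linear_system wt D = {D'. (\<forall>v. D' v \<ge> 0) \<and> linearly_equivalent wt D' D}"


section \<open>Polynomials\<close>

text \<open>
  Polynomials over \<open>\<complex>\<close> with one variable for each vertex, as finitely supported functions on
  exponent vectors; the multiplication of \<^theory>\<open>HOL-Library.Poly_Mapping\<close> is convolution.
\<close>

type_synonym 'v mpoly = "('v \<Rightarrow>\<^sub>0 nat) \<Rightarrow>\<^sub>0 complex"

definition monomial :: "('v \<Rightarrow>\<^sub>0 nat) \<Rightarrow> 'v mpoly" where
  "monomial u = Poly_Mapping.single u 1"

definition Const :: "complex \<Rightarrow> 'v mpoly" where
  "Const c = Poly_Mapping.single 0 c"

definition Var :: "'v \<Rightarrow> 'v mpoly" where
  "Var v = monomial (Poly_Mapping.single v 1)"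

definition scale :: "complex \<Rightarrow> 'v mpoly \<Rightarrow> 'v mpoly" where
  "scale c p = Const c * p"

global_interpretation mpoly: vector_space scale
  by unfold_locales
    (simp_all add: scale_def Const_def algebra_simps single_add
      mult_single[symmetric, where k = 0 and l = 0, simplified])

definition eval_mpoly :: "('v::finite \<Rightarrow> complex) \<Rightarrow> 'v mpoly \<Rightarrow> complex" where
  "eval_mpoly z p =
     (\<Sum>m\<in>Poly_Mapping.keys p. Poly_Mapping.lookup p m * (\<Prod>v\<in>UNIV. z v ^ Poly_Mapping.lookup m v))"

abbreviation mpoly_ring :: "'v mpoly ring" where
  "mpoly_ring \<equiv> ring_of_type_algebra"

definition linear_form :: "'v::finite mpoly \<Rightarrow> bool" where
  "linear_form a \<longleftrightarrow> (\<exists>c. a = (\<Sum>v\<in>UNIV. scale (c v) (Var v)))"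

text \<open>Points of projective space are represented by their nonzero homogeneous coordinate vectors.\<close>

definition projective_zeros :: "'v::finite mpoly set \<Rightarrow> ('v \<Rightarrow> complex) set" where
  "projective_zeros I = {z. (\<exists>v. z v \<noteq> 0) \<and> (\<forall>f\<in>I. eval_mpoly z f = 0)}"


section \<open>Gorenstein sandpile graphs\<close>

definition toppling_ideal :: "('v::finite \<Rightarrow> 'v \<Rightarrow> nat) \<Rightarrow> 'v mpoly set" where
  "toppling_ideal wt = mpoly.span {monomial u - monomial v | u v.
     (\<lambda>i. int (Poly_Mapping.lookup u i) - int (Poly_Mapping.lookup v i)) \<in> range (laplacian wt)}"

definition irrelevant_ideal :: "'v mpoly set" where
  "irrelevant_ideal = Idl\<^bsub>mpoly_ring\<^esub> (range Var)"

definition quotient_scalars :: "'v mpoly set \<Rightarrow> 'v mpoly set set" where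
  "quotient_scalars J = range (\<lambda>c. J +>\<^bsub>mpoly_ring\<^esub> Const c)"

definition socle :: "'v mpoly set \<Rightarrow> 'v mpoly set set" where
  "socle J = {f \<in> carrier (mpoly_ring Quot J).
     \<forall>g\<in>irrelevant_ideal.
       f \<otimes>\<^bsub>mpoly_ring Quot J\<^esub> (J +>\<^bsub>mpoly_ring\<^esub> g) = \<zero>\<^bsub>mpoly_ring Quot J\<^esub>}"

text \<open>
  The following says that the quotient \<open>B\<close> of the polynomial ring by a homogeneous ideal \<open>J\<close> is
  Artinian Gorenstein. Dimensions over \<open>\<complex>\<close> are those of \<open>HOL-Algebra\<close>, taken over the image of
  the constants in \<open>B\<close>.
\<close>

definition artinian_gorenstein :: "'v mpoly set \<Rightarrow> bool" where
  "artinian_gorenstein J \<longleftrightarrow>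
     ring.finite_dimension (mpoly_ring Quot J) (quotient_scalars J) (carrier (mpoly_ring Quot J)) \<and>
     ring.dimension (mpoly_ring Quot J) 1 (quotient_scalars J) (socle J)"

text \<open>
  For the homogeneous toppling ideal \<open>I\<close> and a linear form \<open>a\<close>, the Artinian reduction
  \<open>(S / I) / (a)\<close> is the quotient of the polynomial ring \<open>S\<close> by the homogeneous ideal \<open>I + (a)\<close>.
\<close>

definition gorenstein_sandpile_graph :: "('v::finite \<Rightarrow> 'v \<Rightarrow> nat) \<Rightarrow> 'v \<Rightarrow> bool" where
  "gorenstein_sandpile_graph wt s \<longleftrightarrow>
     sandpile_graph wt s \<and>
     (\<exists>a. linear_form a \<and>
          (\<forall>z\<in>projective_zeros (toppling_ideal wt). eval_mpoly z a \<noteq> 0) \<and>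
          artinian_gorenstein (toppling_ideal wt <+>\<^bsub>mpoly_ring\<^esub> PIdl\<^bsub>mpoly_ring\<^esub> a))"


section \<open>Wirings\<close>

text \<open>The disjoint union of the vertex sets is the sum type, with sinks \<open>Inl s1\<close> and \<open>Inr s2\<close>.\<close>

definition wiring_divisor :: "'a::finite \<Rightarrow> ('a + 'b::finite \<Rightarrow> 'a + 'b \<Rightarrow> nat) \<Rightarrow> 'a \<Rightarrow> int" where
  "wiring_divisor s1 wt = (\<lambda>v. laplacian wt (vertex_divisor (Inl s1)) (Inl v))"

definition wiring ::
  "('a::finite \<Rightarrow> 'a \<Rightarrow> nat) \<Rightarrow> 'a \<Rightarrow> ('b::finite \<Rightarrow> 'b \<Rightarrow> nat) \<Rightarrow> 'b \<Rightarrow> ('a + 'b \<Rightarrow> 'a + 'b \<Rightarrow> nat) \<Rightarrow> bool"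
  where
  "wiring wt1 s1 wt2 s2 wt \<longleftrightarrow>
     sandpile_graph wt (Inr s2) \<and> absolute_sink wt (Inr s2) \<and>
     (\<forall>u v. u \<noteq> s1 \<longrightarrow> wt (Inl u) (Inl v) = wt1 u v) \<and>
     (\<forall>u v. wt (Inr u) (Inr v) = wt2 u v) \<and>
     (\<forall>u v. u \<noteq> s1 \<longrightarrow> wt (Inl u) (Inr v) = 0) \<and>
     (\<forall>u v. wt (Inr u) (Inl v) = 0) \<and>
     (\<exists>v. wt (Inl s1) (Inr v) > 0) \<and>
     complete_linear_system wt1 (wiring_divisor s1 wt) \<noteq> {}"

end

theory Submission
  imports Defs "HOL-Library.Function_Algebras"
begin

text \<open>
  Let \<open>I\<close> be the homogeneous toppling ideal of a sandpile graph, \<open>S\<close> the polynomial ring and \<open>L\<close> the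
  image of the Laplacian. Then \<open>S / I\<close> is the semigroup algebra of the effective divisor classes in
  \<open>\<int>V / L\<close>, a cancellative semigroup graded by degree. Every monomial is therefore regular on \<open>S / I\<close>, and
  the quotient by the monomial of an effective divisor \<open>d\<close> has as a basis the classes that are effective
  but do not remain so after subtracting \<open>d\<close>; they are called residual here. The socle of this
  quotient is spanned by the maximal residual classes (\<open>one_dimensional_socle_monomial_iff\<close>).
  
  The Gorenstein property provides a one-dimensional socle modulo some linear form. The linear form is
  regular because its quotient is Artinian (\<open>regular_if_finite_codimension\<close>), and the dimension of the
  socle is the same for all regular elements of the irrelevant ideal, by the map \<open>f \<mapsto> f b / a\<close>
  (\<open>one_dimensional_socle_transfer\<close>). Hence, in a Gorenstein sandpile graph there is exactly one maximal
  residual class for every nonzero effective divisor \<open>d\<close>.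
  
  The lattice of a wiring is generated by those of the two graphs and \<open>d - e\<close>, where \<open>d\<close> is an
  effective divisor in the linear system of the wiring divisor and \<open>e\<close> is given by the edges from the
  sink of the first graph into the second (\<open>glued_lattices_wiring\<close>). Algebraically, the quotient for the
  wiring is the tensor product of those for the two graphs modulo the binomial of \<open>d\<close> and \<open>e\<close>. On
  divisor classes this means: trading copies of \<open>d\<close> for \<open>e\<close> as long as possible, the residual classes
  of the wiring with respect to its sink become pairs of a residual class with respect to \<open>d\<close> on the first
  graph and one with respect to the sink on the second, and maximal classes correspond to pairs of maximal
  classes (\<open>maximal_residual_join\<close>). So there is exactly one.
  
  The variable of the sink is thus a linear form with a one-dimensional socle. Since every vertex has a
  path to the sink, all variables are nilpotent modulo the sink (\<open>Var_nilpotent_mod_sink\<close>), which gives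
  both the finite dimension of the quotient and that the sink vanishes at no projective zero.
\<close>

section \<open>Quotients of the polynomial ring\<close>

abbreviation coset :: "'v mpoly set \<Rightarrow> 'v mpoly \<Rightarrow> 'v mpoly set" where
  "coset J p \<equiv> J +>\<^bsub>mpoly_ring\<^esub> p"

lemma cring_mpoly_ring: "cring (mpoly_ring :: 'v mpoly ring)"
  by (rule cring_from_type_algebra)

lemma ring_mpoly_ring: "ring (mpoly_ring :: 'v mpoly ring)"
  by (rule ring_from_type_algebra)

lemma mpoly_ring_sel [simp]:
  "carrier (mpoly_ring :: 'v mpoly ring) = UNIV"
  "x \<otimes>\<^bsub>mpoly_ring\<^esub> y = (x * y :: 'v mpoly)"
  "x \<oplus>\<^bsub>mpoly_ring\<^esub> y = (x + y :: 'v mpoly)"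
  "\<zero>\<^bsub>mpoly_ring\<^esub> = (0 :: 'v mpoly)"
  "\<one>\<^bsub>mpoly_ring\<^esub> = (1 :: 'v mpoly)"
  by (simp_all add: ring_of_type_algebra_def)

lemma a_inv_mpoly_ring [simp]: "\<ominus>\<^bsub>mpoly_ring\<^esub> x = - (x :: 'v mpoly)"
  by (rule abelian_group.minus_equality[OF ring.is_abelian_group[OF ring_mpoly_ring]]) auto

lemma ideal_mpoly_ring_iff:
  fixes J :: "'v mpoly set"
  shows "ideal J mpoly_ring \<longleftrightarrow> 0 \<in> J \<and> (\<forall>p\<in>J. \<forall>q\<in>J. p + q \<in> J) \<and> (\<forall>r. \<forall>p\<in>J. r * p \<in> J)"
  (is "_ \<longleftrightarrow> ?R")
proof
  assume "ideal J mpoly_ring"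
  then interpret ideal J "mpoly_ring :: 'v mpoly ring" .
  show ?R
    using additive_subgroup.zero_closed[OF is_additive_subgroup] additive_subgroup.a_closed[OF is_additive_subgroup] I_l_closed
    by (simp del: zero_closed)
next
  assume R: ?R
  have neg: "- p \<in> J" if "p \<in> J" for p
    using R that by (metis mult_minus1)
  show "ideal J mpoly_ring"
  proof (rule idealI[OF ring_mpoly_ring])
    show "subgroup J (add_monoid mpoly_ring)"
    proof (rule group.subgroupI)
      show "group (add_monoid (mpoly_ring :: 'v mpoly ring))"
        using ring_mpoly_ring abelian_group.a_group ring.is_abelian_group by blast
      show "inv\<^bsub>add_monoid mpoly_ring\<^esub> a \<in> J" if "a \<in> J" for a
        using neg[OF that] a_inv_mpoly_ring[of a] by (simp add: a_inv_def)
    qed (use R in auto)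
    show "a \<otimes>\<^bsub>mpoly_ring\<^esub> x \<in> J" if "a \<in> J" for a x
      using R that by (metis mpoly_ring_sel(2) mult.commute)
  qed (use R in auto)
qed

lemma
  fixes J :: "'v mpoly set"
  assumes "ideal J mpoly_ring"
  shows ideal_zero: "0 \<in> J"
    and ideal_add: "p \<in> J \<Longrightarrow> q \<in> J \<Longrightarrow> p + q \<in> J"
    and ideal_mult: "p \<in> J \<Longrightarrow> r * p \<in> J"
    and ideal_mult': "p \<in> J \<Longrightarrow> p * r \<in> J"
    and ideal_scale: "p \<in> J \<Longrightarrow> scale c p \<in> J"
    and ideal_diff: "p \<in> J \<Longrightarrow> q \<in> J \<Longrightarrow> p - q \<in> J"
    and subspace_ideal: "mpoly.subspace J"
proof -
  note J = assms[unfolded ideal_mpoly_ring_iff]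
  show "0 \<in> J" using J by blast
  show add: "p + q \<in> J" if "p \<in> J" "q \<in> J" for p q using J that by blast
  show mult: "r * p \<in> J" if "p \<in> J" for r p using J that by blast
  show "p * r \<in> J" if "p \<in> J" using mult[OF that, of r] by (simp only: mult.commute[of p r])
  show "scale c p \<in> J" if "p \<in> J" using mult[OF that] by (simp add: scale_def)
  have um: "- p \<in> J" if "p \<in> J" for p using mult[OF that, of "- 1"] by simp
  show "p - q \<in> J" if "p \<in> J" "q \<in> J" using add[OF that(1) um[OF that(2)]] by simp
  show "mpoly.subspace J"
    by (rule mpoly.subspaceI) (use J in \<open>auto simp: scale_def\<close>)
qed

lemma add_principal_eq:
  "I <+>\<^bsub>mpoly_ring\<^esub> PIdl\<^bsub>mpoly_ring\<^esub> a = {i + h * a | i h. i \<in> I}" for a :: "'v mpoly"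
  by (auto simp: set_add_def' cgenideal_def)

lemma ideal_add_principal:
  fixes a :: "'v mpoly"
  assumes "ideal I mpoly_ring"
  shows "ideal (I <+>\<^bsub>mpoly_ring\<^esub> PIdl\<^bsub>mpoly_ring\<^esub> a) mpoly_ring"
  by (rule ring.add_ideals[OF ring_mpoly_ring assms cring.cgenideal_ideal[OF cring_mpoly_ring]]) simp

lemma in_add_principal_iff:
  "p \<in> I <+>\<^bsub>mpoly_ring\<^esub> PIdl\<^bsub>mpoly_ring\<^esub> a \<longleftrightarrow> (\<exists>h. p - h * a \<in> I)" for a :: "'v mpoly"
  unfolding add_principal_eq by (auto, metis add_diff_cancel_right', metis diff_add_cancel)

lemma coset_eq_iff:
  assumes "ideal J mpoly_ring"
  shows "coset J p = coset J q \<longleftrightarrow> p - q \<in> J"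
  using ring.quotient_eq_iff_same_a_r_cos[OF ring_mpoly_ring assms, of p q]
  by (simp add: a_minus_def)

lemma carrier_quotient: "carrier (mpoly_ring Quot J) = range (coset J)"
  by (auto simp: FactRing_def A_RCOSETS_def')

lemma quotient_ops:
  assumes "ideal J mpoly_ring"
  shows "coset J p \<otimes>\<^bsub>mpoly_ring Quot J\<^esub> coset J q = coset J (p * q)"
    and "coset J p \<oplus>\<^bsub>mpoly_ring Quot J\<^esub> coset J q = coset J (p + q)"
    and "\<zero>\<^bsub>mpoly_ring Quot J\<^esub> = coset J 0"
proof -
  show "coset J p \<otimes>\<^bsub>mpoly_ring Quot J\<^esub> coset J q = coset J (p * q)"
    using ideal.rcoset_mult_add[OF assms, of p q] by (simp add: FactRing_def)
  show "coset J p \<oplus>\<^bsub>mpoly_ring Quot J\<^esub> coset J q = coset J (p + q)"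
    using ideal.a_rcos_sum[OF assms, of p q] by (simp add: FactRing_def)
  show "\<zero>\<^bsub>mpoly_ring Quot J\<^esub> = coset J 0"
    using ring.a_rcos_zero[OF ring_mpoly_ring assms ideal_zero[OF assms]] by (simp add: FactRing_def)
qed

text \<open>
  The dimension of a set is defined by adjoining one line at a time. A line extension of the image of a
  set of polynomials is again such an image, so dimensions of quotients can be discussed through
  spans of polynomials upstairs. This also covers the improper ideal, where the scalars are not a
  field.
\<close>

lemma line_extension_coset:
  assumes "ideal J mpoly_ring"
  shows "ring.line_extension (mpoly_ring Quot J) (quotient_scalars J) (coset J f) (coset J ` E)
         = coset J ` {scale c f + e | c e. e \<in> E}"
proof -
  interpret Q: ring "mpoly_ring Quot J" by (rule ideal.quotient_is_ring[OF assms])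
  have "quotient_scalars J #>\<^bsub>mpoly_ring Quot J\<^esub> coset J f = range (\<lambda>c. coset J (scale c f))"
    by (auto simp: r_coset_def quotient_scalars_def quotient_ops[OF assms] scale_def)
  then have "Q.line_extension (quotient_scalars J) (coset J f) (coset J ` E) =
        {coset J (scale c f) \<oplus>\<^bsub>mpoly_ring Quot J\<^esub> coset J e | c e. e \<in> E}"
    by (auto simp: Q.line_extension_def set_add_def')
  also have "\<dots> = coset J ` {scale c f + e | c e. e \<in> E}"
    by (auto simp: quotient_ops[OF assms])
  finally show ?thesis .
qed

lemma span_insert_eq: "mpoly.span (insert f F) = {scale c f + e | c e. e \<in> mpoly.span F}"
  unfolding mpoly.span_insert
  by (auto, metis add.commute diff_add_cancel, metis add_diff_cancel_left')

lemma finite_dimension_quotient_iff: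
  assumes "ideal J mpoly_ring"
  shows "ring.finite_dimension (mpoly_ring Quot J) (quotient_scalars J) (coset J ` W) \<longleftrightarrow>
         (\<exists>F. finite F \<and> coset J ` W = coset J ` mpoly.span F)"
proof -
  interpret Q: ring "mpoly_ring Quot J" by (rule ideal.quotient_is_ring[OF assms])
  let ?K = "quotient_scalars J"
  have 1: "\<exists>F. finite F \<and> E = coset J ` mpoly.span F" if "Q.dimension n K E" "K = ?K" for n K E
    using that
  proof (induction rule: Q.dimension.induct)
    case (zero_dim K)
    show ?case by (rule exI[of _ "{}"]) (simp add: quotient_ops[OF assms])
  next
    case (Suc_dim v E n K)
    then obtain F f where F: "finite F" "E = coset J ` mpoly.span F" and f: "v = coset J f"
      by (auto simp: carrier_quotient)
    have "Q.line_extension K v E = coset J ` mpoly.span (insert f F)"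
      by (simp add: F f Suc_dim.prems line_extension_coset[OF assms] span_insert_eq)
    then show ?case using F(1) by blast
  qed
  have 2: "\<exists>n. Q.dimension n ?K (coset J ` mpoly.span F)" if "finite F" for F
    using that
  proof (induction F)
    case empty
    show ?case using Q.zero_dim[of ?K] by (auto simp: quotient_ops[OF assms])
  next
    case (insert f F)
    then obtain n where n: "Q.dimension n ?K (coset J ` mpoly.span F)" by blast
    show ?case
    proof (cases "coset J f \<in> coset J ` mpoly.span F")
      case False
      then have "Q.dimension (Suc n) ?K (coset J ` mpoly.span (insert f F))"
        using Q.Suc_dim[OF _ False n] by (simp add: line_extension_coset[OF assms] span_insert_eq carrier_quotient)
      then show ?thesis ..
    next
      case True
      then obtain e where e: "e \<in> mpoly.span F" "f - e \<in> J" by (auto simp: coset_eq_iff[OF assms])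
      have "coset J p \<in> coset J ` mpoly.span F" if "p \<in> mpoly.span (insert f F)" for p
      proof -
        obtain c q where q: "p = scale c f + q" "q \<in> mpoly.span F"
          using \<open>p \<in> mpoly.span (insert f F)\<close> unfolding span_insert_eq by blast
        have "p - (scale c e + q) = scale c (f - e)"
          by (simp add: q mpoly.scale_right_diff_distrib)
        then have "coset J p = coset J (scale c e + q)"
          using ideal_scale[OF assms e(2), of c] by (simp add: coset_eq_iff[OF assms])
        then show ?thesis using e(1) q(2) by (auto intro: mpoly.span_add mpoly.span_scale)
      qed
      moreover have "mpoly.span F \<subseteq> mpoly.span (insert f F)"
        by (rule mpoly.span_mono) auto
      ultimately have "coset J ` mpoly.span (insert f F) = coset J ` mpoly.span F" by blast
      then show ?thesis using n by auto
    qed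
  qed
  show ?thesis
    using 1[OF _ refl] 2 unfolding Q.finite_dimension_def by metis
qed

lemma one_dimensional_quotient_iff:
  assumes "ideal J mpoly_ring"
  shows "ring.dimension (mpoly_ring Quot J) 1 (quotient_scalars J) E \<longleftrightarrow>
         (\<exists>f. f \<notin> J \<and> E = coset J ` range (\<lambda>c. scale c f))"
proof -
  interpret Q: ring "mpoly_ring Quot J" by (rule ideal.quotient_is_ring[OF assms])
  have zero: "{\<zero>\<^bsub>mpoly_ring Quot J\<^esub>} = coset J ` {0}"
    by (simp add: quotient_ops[OF assms])
  have mem: "coset J f \<notin> {\<zero>\<^bsub>mpoly_ring Quot J\<^esub>} \<longleftrightarrow> f \<notin> J" for f
    by (simp add: quotient_ops[OF assms] coset_eq_iff[OF assms])
  have ext: "Q.line_extension (quotient_scalars J) (coset J f) {\<zero>\<^bsub>mpoly_ring Quot J\<^esub>}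
      = coset J ` range (\<lambda>c. scale c f)" for f
    unfolding zero line_extension_coset[OF assms] by (rule arg_cong[of _ _ "image (coset J)"]) auto
  show ?thesis
  proof
    assume "Q.dimension 1 (quotient_scalars J) E"
    then obtain v where "v \<in> carrier (mpoly_ring Quot J)" "v \<notin> {\<zero>\<^bsub>mpoly_ring Quot J\<^esub>}"
        "E = Q.line_extension (quotient_scalars J) v {\<zero>\<^bsub>mpoly_ring Quot J\<^esub>}"
      by (auto elim!: Q.dimension.cases)
    then obtain f where "coset J f \<notin> {\<zero>\<^bsub>mpoly_ring Quot J\<^esub>}"
        "E = Q.line_extension (quotient_scalars J) (coset J f) {\<zero>\<^bsub>mpoly_ring Quot J\<^esub>}"
      unfolding carrier_quotient by blast
    then show "\<exists>f. f \<notin> J \<and> E = coset J ` range (\<lambda>c. scale c f)"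
      unfolding mem ext by blast
  next
    assume "\<exists>f. f \<notin> J \<and> E = coset J ` range (\<lambda>c. scale c f)"
    then obtain f where f: "f \<notin> J" "E = coset J ` range (\<lambda>c. scale c f)" by blast
    show "Q.dimension 1 (quotient_scalars J) E"
      using Q.Suc_dim[OF _ mem[THEN iffD2, OF f(1)] Q.zero_dim[of "quotient_scalars J"]]
      by (simp add: ext f(2) carrier_quotient)
  qed
qed

section \<open>One-dimensional socles and change of the regular element\<close>

text \<open>
  The preimage in the polynomial ring of the socle of the quotient by \<open>J\<close>.
\<close>

definition colon_irrelevant :: "'v mpoly set \<Rightarrow> 'v mpoly set" where
  "colon_irrelevant J = {p. \<forall>g\<in>irrelevant_ideal. p * g \<in> J}"

lemma ideal_irrelevant: "ideal irrelevant_ideal mpoly_ring"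
  unfolding irrelevant_ideal_def by (rule ring.genideal_ideal[OF ring_mpoly_ring]) simp

lemma Var_irrelevant: "Var v \<in> irrelevant_ideal"
  unfolding irrelevant_ideal_def using ring.genideal_self[OF ring_mpoly_ring, of "range Var"] by auto

lemma colon_irrelevant_iff:
  assumes "ideal J mpoly_ring"
  shows "p \<in> colon_irrelevant J \<longleftrightarrow> (\<forall>v. p * Var v \<in> J)"
proof
  assume "\<forall>v. p * Var v \<in> J"
  moreover have "ideal {g. p * g \<in> J} mpoly_ring"
    using assms unfolding ideal_mpoly_ring_iff by (simp add: distrib_left mult.left_commute)
  ultimately have "irrelevant_ideal \<subseteq> {g. p * g \<in> J}"
    unfolding irrelevant_ideal_def by (intro ring.genideal_minimal[OF ring_mpoly_ring]) auto
  then show "p \<in> colon_irrelevant J" by (auto simp: colon_irrelevant_def)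
qed (simp add: colon_irrelevant_def Var_irrelevant)

lemma socle_eq:
  assumes "ideal J mpoly_ring"
  shows "socle J = coset J ` colon_irrelevant J"
proof -
  have "coset J p \<otimes>\<^bsub>mpoly_ring Quot J\<^esub> coset J g = \<zero>\<^bsub>mpoly_ring Quot J\<^esub> \<longleftrightarrow> p * g \<in> J" for p g
    by (simp add: quotient_ops[OF assms] coset_eq_iff[OF assms])
  then show ?thesis
    unfolding socle_def colon_irrelevant_def carrier_quotient by blast
qed

text \<open>
  The socle condition in terms of representatives: up to elements of \<open>J\<close>, everything that multiplies
  the variables into \<open>J\<close> is a multiple of one such element, which is not in \<open>J\<close> itself.
\<close>

definition one_dimensional_socle :: "'v mpoly set \<Rightarrow> bool" where
  "one_dimensional_socle J \<longleftrightarrow>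
     (\<exists>q\<in>colon_irrelevant J. q \<notin> J \<and> (\<forall>p\<in>colon_irrelevant J. \<exists>c. p - scale c q \<in> J))"

lemma one_dimensional_socle_iff:
  assumes J: "ideal J mpoly_ring"
  shows "ring.dimension (mpoly_ring Quot J) 1 (quotient_scalars J) (socle J) \<longleftrightarrow> one_dimensional_socle J"
proof -
  have scale: "scale c q \<in> colon_irrelevant J" if "q \<in> colon_irrelevant J" for c q
    using that ideal_mult[OF J, of _ "Const c"] by (auto simp: colon_irrelevant_def scale_def mult.assoc)
  have "socle J = coset J ` range (\<lambda>c. scale c q) \<longleftrightarrow>
        q \<in> colon_irrelevant J \<and> (\<forall>p\<in>colon_irrelevant J. \<exists>c. p - scale c q \<in> J)" for q
  proof
    assume eq: "socle J = coset J ` range (\<lambda>c. scale c q)"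
    have "\<exists>c. p - scale c q \<in> J" if "p \<in> colon_irrelevant J" for p
    proof -
      have "coset J p \<in> coset J ` range (\<lambda>c. scale c q)"
        using that eq by (auto simp: socle_eq[OF J])
      then show ?thesis by (auto simp: coset_eq_iff[OF J])
    qed
    moreover have "q \<in> colon_irrelevant J"
    proof -
      have "coset J (scale 1 q) \<in> socle J" unfolding eq by blast
      then obtain p where p: "p \<in> colon_irrelevant J" "q - p \<in> J"
        by (auto simp: socle_eq[OF J] coset_eq_iff[OF J])
      have "q * g \<in> J" if "g \<in> irrelevant_ideal" for g
        using ideal_add[OF J ideal_mult'[OF J p(2), of g], of "p * g"] p(1) that
        by (simp add: colon_irrelevant_def algebra_simps)
      then show ?thesis by (simp add: colon_irrelevant_def)
    qed
    ultimately show "q \<in> colon_irrelevant J \<and> (\<forall>p\<in>colon_irrelevant J. \<exists>c. p - scale c q \<in> J)"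
      by blast
  next
    assume q: "q \<in> colon_irrelevant J \<and> (\<forall>p\<in>colon_irrelevant J. \<exists>c. p - scale c q \<in> J)"
    have "coset J p \<in> coset J ` range (\<lambda>c. scale c q)" if "p \<in> colon_irrelevant J" for p
      using q that by (auto simp: coset_eq_iff[OF J] image_iff)
    moreover have "coset J (scale c q) \<in> socle J" for c
      using q scale by (auto simp: socle_eq[OF J])
    ultimately show "socle J = coset J ` range (\<lambda>c. scale c q)"
      by (auto simp: socle_eq[OF J])
  qed
  then show ?thesis
    unfolding one_dimensional_quotient_iff[OF J] one_dimensional_socle_def by auto
qed

lemma artinian_gorenstein_iff:
  assumes J: "ideal J mpoly_ring"
  shows "artinian_gorenstein J \<longleftrightarrow>
    (\<exists>F. finite F \<and> (\<forall>p. \<exists>e\<in>mpoly.span F. p - e \<in> J)) \<and> one_dimensional_socle J"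
proof -
  have "range (coset J) = coset J ` mpoly.span F \<longleftrightarrow> (\<forall>p. \<exists>e\<in>mpoly.span F. p - e \<in> J)" for F
    unfolding coset_eq_iff[OF J, symmetric] by blast
  then show ?thesis
    unfolding artinian_gorenstein_def one_dimensional_socle_iff[OF J] carrier_quotient
      finite_dimension_quotient_iff[OF J] by simp
qed



text \<open>
  In homological terms, for every regular element \<open>a\<close> of the irrelevant ideal the socle of
  \<open>(S / I) / (a)\<close> is isomorphic to \<open>Ext\<^sup>1(\<complex>, S / I)\<close>, hence does not depend on \<open>a\<close> as a vector space. The
  isomorphism between the socles for \<open>a\<close> and \<open>b\<close> is \<open>f \<mapsto> f b / a\<close>: as \<open>b\<close> is in the irrelevant
  ideal, \<open>f b\<close> is a multiple of \<open>a\<close> modulo \<open>I\<close>, and its quotient by \<open>a\<close> is unique modulo \<open>I\<close> by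
  regularity. The two elements may have different degrees, which allows passing from the linear form
  of a Gorenstein graph to an arbitrary monomial.
\<close>

lemma one_dimensional_socle_transfer:
  fixes I :: "'v mpoly set" and a b :: "'v mpoly"
  defines "Ja \<equiv> I <+>\<^bsub>mpoly_ring\<^esub> PIdl\<^bsub>mpoly_ring\<^esub> a"
    and "Jb \<equiv> I <+>\<^bsub>mpoly_ring\<^esub> PIdl\<^bsub>mpoly_ring\<^esub> b"
  assumes I: "ideal I mpoly_ring"
    and a: "a \<in> irrelevant_ideal" "\<And>f. f * a \<in> I \<Longrightarrow> f \<in> I"
    and b: "b \<in> irrelevant_ideal" "\<And>f. f * b \<in> I \<Longrightarrow> f \<in> I"
    and "one_dimensional_socle Ja"
  shows "one_dimensional_socle Jb"
proof -
  \<comment> \<open>Division by \<open>a\<close> takes socle elements for \<open>a\<close> to socle elements for \<open>b\<close>. It is stated for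
    bound \<open>a\<close> and \<open>b\<close> because the argument below needs it in both directions.\<close>
  have swap: "g \<in> colon_irrelevant Jb"
    if "f \<in> colon_irrelevant Ja" "f * b - g * a \<in> I"
      and a: "\<And>f. f * a \<in> I \<Longrightarrow> f \<in> I"
      and Ja: "Ja = I <+>\<^bsub>mpoly_ring\<^esub> PIdl\<^bsub>mpoly_ring\<^esub> a" and Jb: "Jb = I <+>\<^bsub>mpoly_ring\<^esub> PIdl\<^bsub>mpoly_ring\<^esub> b"
    for f g a b Ja and Jb :: "'v mpoly set"
    unfolding colon_irrelevant_def
  proof safe
    fix x :: "'v mpoly" assume x: "x \<in> irrelevant_ideal"
    then have "f * x \<in> Ja"
      using that(1) unfolding colon_irrelevant_def by blast
    then obtain h where h: "f * x - h * a \<in> I"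
      unfolding Ja in_add_principal_iff by blast
    have "b * (f * x - h * a) - x * (f * b - g * a) \<in> I"
      by (rule ideal_diff[OF I ideal_mult[OF I h] ideal_mult[OF I that(2)]])
    then have "(g * x - h * b) * a \<in> I" by (simp add: algebra_simps)
    then show "g * x \<in> Jb" using a by (auto simp: Jb in_add_principal_iff)
  qed
  obtain q where q: "q \<in> colon_irrelevant Ja" "q \<notin> Ja"
      and gen: "\<And>p. p \<in> colon_irrelevant Ja \<Longrightarrow> \<exists>c. p - scale c q \<in> Ja"
    using assms(8) unfolding one_dimensional_socle_def by blast
  obtain g where g: "q * b - g * a \<in> I"
    using q(1) b(1) by (auto simp: colon_irrelevant_def Ja_def in_add_principal_iff)
  have "g \<in> colon_irrelevant Jb"
    using swap[OF q(1) g a(2)] Ja_def Jb_def by blast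
  moreover have "g \<notin> Jb"
  proof
    assume "g \<in> Jb"
    then obtain h where "g - h * b \<in> I" by (auto simp: Jb_def in_add_principal_iff)
    then have "(q * b - g * a) + (g - h * b) * a \<in> I"
      using g by (intro ideal_add[OF I] ideal_mult'[OF I])
    then have "(q - h * a) * b \<in> I" by (simp add: algebra_simps)
    then show False using b(2) q(2) by (auto simp: Ja_def in_add_principal_iff)
  qed
  moreover have "\<exists>c. p - scale c g \<in> Jb" if p: "p \<in> colon_irrelevant Jb" for p
  proof -
    obtain r where r: "p * a - r * b \<in> I"
      using p a(1) by (auto simp: colon_irrelevant_def Jb_def in_add_principal_iff)
    have "r \<in> colon_irrelevant Ja"
      using swap[OF p r b(2)] Ja_def Jb_def by blast
    then obtain c h where "r - scale c q - h * a \<in> I"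
      using gen by (fastforce simp: Ja_def in_add_principal_iff)
    then have "(p * a - r * b) + b * (r - scale c q - h * a) + scale c (q * b - g * a) \<in> I"
      using r g by (intro ideal_add[OF I] ideal_mult[OF I] ideal_scale[OF I])
    then have "(p - scale c g - h * b) * a \<in> I" by (simp add: scale_def algebra_simps)
    then show ?thesis using a(2) by (auto simp: Jb_def in_add_principal_iff)
  qed
  ultimately show ?thesis unfolding one_dimensional_socle_def by blast
qed

section \<open>Polynomials as combinations of monomials\<close>

lemma lookup_monomial: "Poly_Mapping.lookup (monomial m) k = of_bool (m = k)"
  by (simp add: monomial_def lookup_single when_def)

lemma lookup_scale: "Poly_Mapping.lookup (scale c p) m = c * Poly_Mapping.lookup p m"
  unfolding scale_def Const_def mult_map_scale_conv_mult[symmetric]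
  by (simp add: Poly_Mapping.map.rep_eq when_def)

lemma monomial_add: "monomial (k + m) = monomial k * monomial m"
  by (simp add: monomial_def mult_single)

lemma monomial_expansion: "p = (\<Sum>m\<in>Poly_Mapping.keys p. scale (Poly_Mapping.lookup p m) (monomial m))"
proof (rule poly_mapping_eqI)
  fix k
  have "(\<Sum>m\<in>Poly_Mapping.keys p. Poly_Mapping.lookup p m * of_bool (m = k)) =
      (\<Sum>m\<in>Poly_Mapping.keys p. if m = k then Poly_Mapping.lookup p m else 0)"
    by (rule sum.cong) auto
  then show "Poly_Mapping.lookup p k =
      Poly_Mapping.lookup (\<Sum>m\<in>Poly_Mapping.keys p. scale (Poly_Mapping.lookup p m) (monomial m)) k"
    by (simp add: lookup_sum lookup_scale lookup_monomial in_keys_iff)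
qed

lemma monomial_induct [case_names zero monomial add]:
  assumes "P 0" "\<And>c m. P (scale c (monomial m))" "\<And>p q. P p \<Longrightarrow> P q \<Longrightarrow> P (p + q)"
  shows "P p"
proof -
  have "P (\<Sum>m\<in>A. scale (Poly_Mapping.lookup p m) (monomial m))" if "finite A" for A
    using that by induction (auto intro: assms)
  then show ?thesis using monomial_expansion[of p] by (metis finite_keys)
qed

text \<open>
  Both evaluation at a point and the class sums below are determined by their values on monomials.
\<close>

definition linear_extension :: "(('v \<Rightarrow>\<^sub>0 nat) \<Rightarrow> complex) \<Rightarrow> 'v mpoly \<Rightarrow> complex" where
  "linear_extension g p = (\<Sum>m\<in>Poly_Mapping.keys p. Poly_Mapping.lookup p m * g m)"

lemma linear_extension_superset:
  assumes "finite A" "Poly_Mapping.keys p \<subseteq> A"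
  shows "linear_extension g p = (\<Sum>m\<in>A. Poly_Mapping.lookup p m * g m)"
  unfolding linear_extension_def
  by (rule sum.mono_neutral_left) (use assms in \<open>auto simp: in_keys_iff\<close>)

lemma linear_extension_zero [simp]: "linear_extension g 0 = 0"
  by (simp add: linear_extension_def)

lemma linear_extension_add: "linear_extension g (p + q) = linear_extension g p + linear_extension g q"
proof -
  let ?A = "Poly_Mapping.keys p \<union> Poly_Mapping.keys q"
  have "linear_extension g r = (\<Sum>m\<in>?A. Poly_Mapping.lookup r m * g m)" if "r \<in> {p, q, p + q}" for r
    by (rule linear_extension_superset) (use that keys_add[of p q] in auto)
  then show ?thesis by (simp add: lookup_add algebra_simps sum.distrib)
qed

lemma linear_extension_scale: "linear_extension g (scale c p) = c * linear_extension g p"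
proof -
  have "linear_extension g (scale c p) = (\<Sum>m\<in>Poly_Mapping.keys p. Poly_Mapping.lookup (scale c p) m * g m)"
    by (rule linear_extension_superset) (auto simp: in_keys_iff lookup_scale)
  then show ?thesis by (simp add: linear_extension_def lookup_scale sum_distrib_left mult.assoc)
qed

lemma linear_extension_diff: "linear_extension g (p - q) = linear_extension g p - linear_extension g q"
proof -
  have "linear_extension g (p + scale (- 1) q) = linear_extension g p - linear_extension g q"
    unfolding linear_extension_add linear_extension_scale by simp
  moreover have "p + scale (- 1) q = p - q" by simp
  ultimately show ?thesis by metis
qed

lemma linear_extension_monomial [simp]: "linear_extension g (monomial m) = g m"
  by (simp add: linear_extension_def monomial_def)

lemma linear_extension_sum: "linear_extension g (sum f A) = (\<Sum>x\<in>A. linear_extension g (f x))"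
  by (induction A rule: infinite_finite_induct) (simp_all add: linear_extension_add)

lemma linear_extension_times_monomial:
  "linear_extension g (p * monomial m) = linear_extension (\<lambda>k. g (k + m)) p"
proof (induction p rule: monomial_induct)
  case (monomial c k)
  have "scale c (monomial k) * monomial m = scale c (monomial (k + m))"
    by (simp add: scale_def monomial_add mult.assoc)
  then show ?case by (simp add: linear_extension_scale)
qed (simp_all add: distrib_right linear_extension_add)

lemma eval_mpoly_eq: "eval_mpoly z = linear_extension (\<lambda>m. \<Prod>v\<in>UNIV. z v ^ Poly_Mapping.lookup m v)"
  by (rule ext) (simp add: eval_mpoly_def linear_extension_def)

lemma eval_mpoly_monomial: "eval_mpoly z (monomial m) = (\<Prod>v\<in>UNIV. z v ^ Poly_Mapping.lookup m v)"
  by (simp add: eval_mpoly_eq)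

lemma eval_mpoly_Var: "eval_mpoly z (Var v) = z v"
  by (simp add: Var_def eval_mpoly_monomial lookup_single when_def if_distrib cong: if_cong)

lemma split_off_variable:
  fixes m :: "'v \<Rightarrow>\<^sub>0 nat"
  assumes "Poly_Mapping.lookup m v \<ge> n"
  shows "m = (m - Poly_Mapping.single v n) + Poly_Mapping.single v n"
  by (rule poly_mapping_eqI) (use assms in \<open>auto simp: lookup_add lookup_minus lookup_single when_def\<close>)

lemma Var_dvd_monomial:
  assumes "Poly_Mapping.lookup m v \<noteq> 0"
  shows "monomial m = monomial (m - Poly_Mapping.single v 1) * Var v"
  using split_off_variable[of 1 m v] assms unfolding Var_def monomial_add[symmetric] by simp

lemma monomial_irrelevant:
  assumes "d \<noteq> 0"
  shows "monomial d \<in> irrelevant_ideal"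
proof -
  obtain v where v: "Poly_Mapping.lookup d v \<noteq> 0"
    using assms by (metis poly_mapping_eqI lookup_zero)
  show ?thesis
    using Var_dvd_monomial[OF v] ideal_mult[OF ideal_irrelevant Var_irrelevant] by metis
qed

lemma linear_form_irrelevant:
  assumes "linear_form a"
  shows "a \<in> irrelevant_ideal"
proof -
  obtain c where "a = (\<Sum>v\<in>UNIV. scale (c v) (Var v))"
    using assms unfolding linear_form_def by blast
  then show ?thesis
    by (auto intro!: mpoly.subspace_sum[OF subspace_ideal[OF ideal_irrelevant]]
        ideal_scale[OF ideal_irrelevant] Var_irrelevant)
qed

lemma linear_form_Var: "linear_form (Var v)"
  unfolding linear_form_def
proof
  show "Var v = (\<Sum>w\<in>UNIV. scale (of_bool (w = v)) (Var w))"
    by (simp add: of_bool_def if_distrib[of "\<lambda>c. scale c _"] cong: if_cong)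
qed

section \<open>Lattice ideals and class sums\<close>

definition exponent :: "('v \<Rightarrow>\<^sub>0 nat) \<Rightarrow> 'v \<Rightarrow> int" where
  "exponent m = (\<lambda>i. int (Poly_Mapping.lookup m i))"

lemma exponent_add: "exponent (k + m) = exponent k + exponent m"
  by (simp add: exponent_def lookup_add fun_eq_iff)

lemma exponent_single: "exponent (Poly_Mapping.single v 1) = vertex_divisor v"
  by (auto simp: exponent_def lookup_single vertex_divisor_def when_def)

lemma ex_exponent:
  fixes u :: "'v::finite \<Rightarrow> int"
  assumes "\<And>i. u i \<ge> 0"
  obtains m where "exponent m = u"
proof
  show "exponent (Abs_poly_mapping (\<lambda>i. nat (u i))) = u"
    using assms by (simp add: exponent_def)
qed

definition degree :: "('v::finite \<Rightarrow> int) \<Rightarrow> int" where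
  "degree u = (\<Sum>i\<in>UNIV. u i)"

lemma degree_add: "degree (u + v) = degree u + degree v"
  and degree_diff: "degree (u - v) = degree u - degree v"
  by (simp_all add: degree_def sum.distrib sum_subtractf)

lemma degree_exponent_nonneg: "degree (exponent m) \<ge> 0"
  by (simp add: degree_def exponent_def sum_nonneg)

lemma degree_vertex_divisor: "degree (vertex_divisor v) = 1"
  by (simp add: degree_def vertex_divisor_def)

text \<open>
  For a subgroup \<open>L\<close> of \<open>\<int>V\<close>, the coefficient of the class of \<open>u\<close> in the image of \<open>p\<close> in the group
  algebra of \<open>\<int>V / L\<close>. These coefficients describe the quotient by the lattice ideal of \<open>L\<close> completely
  (\<open>mem_lattice_ideal_iff\<close>), which turns it into the semigroup algebra of effective divisor classes.
\<close>

definition class_sum :: "('v \<Rightarrow> int) set \<Rightarrow> ('v \<Rightarrow> int) \<Rightarrow> 'v mpoly \<Rightarrow> complex" where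
  "class_sum L u = linear_extension (\<lambda>m. of_bool (exponent m - u \<in> L))"

lemma class_sum_linear:
  "class_sum L u 0 = 0"
  "class_sum L u (p + q) = class_sum L u p + class_sum L u q"
  "class_sum L u (p - q) = class_sum L u p - class_sum L u q"
  "class_sum L u (scale c p) = c * class_sum L u p"
  "class_sum L u (sum f A) = (\<Sum>x\<in>A. class_sum L u (f x))"
  by (simp_all add: class_sum_def linear_extension_add linear_extension_diff linear_extension_scale linear_extension_sum)

lemma class_sum_monomial: "class_sum L u (monomial m) = of_bool (exponent m - u \<in> L)"
  by (simp add: class_sum_def)

lemma class_sum_times_monomial:
  "class_sum L u (p * monomial m) = class_sum L (u - exponent m) p"
proof -
  have "exponent (k + m) - u = exponent k - (u - exponent m)" for k
    by (simp add: exponent_add)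
  then show ?thesis unfolding class_sum_def linear_extension_times_monomial by (simp only:)
qed

definition lattice_ideal :: "('v \<Rightarrow> int) set \<Rightarrow> 'v mpoly set" where
  "lattice_ideal L = mpoly.span {monomial u - monomial v | u v. exponent u - exponent v \<in> L}"

lemma toppling_ideal_eq: "toppling_ideal wt = lattice_ideal (range (laplacian wt))"
proof -
  have "(\<lambda>i. int (Poly_Mapping.lookup u i) - int (Poly_Mapping.lookup v i)) = exponent u - exponent v"
    for u v :: "'a \<Rightarrow>\<^sub>0 nat"
    by (simp add: exponent_def fun_eq_iff)
  then show ?thesis by (simp add: toppling_ideal_def lattice_ideal_def)
qed

definition effective :: "('v \<Rightarrow> int) set \<Rightarrow> ('v \<Rightarrow> int) \<Rightarrow> bool" where
  "effective L u \<longleftrightarrow> (\<exists>m. u - exponent m \<in> L)"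

text \<open>
  The classes that are effective but no longer so after subtracting \<open>d\<close>: their monomials form a basis
  of the semigroup algebra modulo the monomial with exponent \<open>d\<close>.
\<close>

definition residual :: "('v \<Rightarrow> int) set \<Rightarrow> ('v \<Rightarrow> int) \<Rightarrow> ('v \<Rightarrow> int) \<Rightarrow> bool" where
  "residual L d u \<longleftrightarrow> effective L u \<and> \<not> effective L (u - d)"

definition maximal_residual :: "('v \<Rightarrow> int) set \<Rightarrow> ('v \<Rightarrow> int) \<Rightarrow> ('v \<Rightarrow> int) \<Rightarrow> bool" where
  "maximal_residual L d u \<longleftrightarrow> residual L d u \<and> (\<forall>v. \<not> residual L d (u + vertex_divisor v))"

locale degree_zero_lattice =
  fixes L :: "('v::finite \<Rightarrow> int) set"
  assumes zero_mem: "0 \<in> L"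
    and diff_mem: "x \<in> L \<Longrightarrow> y \<in> L \<Longrightarrow> x - y \<in> L"
    and degree_mem: "x \<in> L \<Longrightarrow> degree x = 0"
begin

lemma uminus_mem: "x \<in> L \<Longrightarrow> - x \<in> L"
  using diff_mem[OF zero_mem] by simp

lemma add_mem: "x \<in> L \<Longrightarrow> y \<in> L \<Longrightarrow> x + y \<in> L"
  using diff_mem[OF _ uminus_mem] by simp

lemma minus_commute_mem: "x - y \<in> L \<Longrightarrow> y - x \<in> L"
  using uminus_mem by fastforce

lemma trans_mem: "x - y \<in> L \<Longrightarrow> y - z \<in> L \<Longrightarrow> x - z \<in> L"
  using add_mem[of "x - y" "y - z"] by simp

lemma class_sum_cong:
  assumes "u - u' \<in> L"
  shows "class_sum L u p = class_sum L u' p"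
proof -
  have "exponent m - u \<in> L \<longleftrightarrow> exponent m - u' \<in> L" for m
    using trans_mem[OF _ assms] trans_mem[OF _ minus_commute_mem[OF assms]] by blast
  then show ?thesis by (simp add: class_sum_def)
qed

text \<open>
  Modulo the lattice ideal, every monomial equals that of a chosen representative of its class.
  Rewriting all monomials of \<open>p\<close> in this way collects the coefficients of each class, so nothing
  remains when all class sums vanish.
\<close>

lemma mem_lattice_ideal_iff: "p \<in> lattice_ideal L \<longleftrightarrow> (\<forall>u. class_sum L u p = 0)"
proof safe
  fix u assume "p \<in> lattice_ideal L"
  then show "class_sum L u p = 0"
    unfolding lattice_ideal_def
  proof (induction rule: mpoly.span_induct)
    case base
    show ?case by (rule mpoly.subspaceI) (auto simp: class_sum_linear)
  next
    case (step x)
    then obtain k m where x: "x = monomial k - monomial m" "exponent k - exponent m \<in> L" by blast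
    have "exponent k - u \<in> L \<longleftrightarrow> exponent m - u \<in> L"
      using trans_mem[OF x(2)] trans_mem[OF minus_commute_mem[OF x(2)]] by blast
    then show ?case by (simp add: x(1) class_sum_linear class_sum_monomial)
  qed
next
  assume p: "\<forall>u. class_sum L u p = 0"
  define rep where "rep m = (SOME k. exponent k - exponent m \<in> L)" for m
  have rep: "exponent (rep m) - exponent m \<in> L" for m
    unfolding rep_def by (rule someI[of _ m]) (use zero_mem in \<open>simp add: zero_fun_def\<close>)
  have rep_eq_iff: "rep k = rep m \<longleftrightarrow> exponent k - exponent m \<in> L" for k m
  proof
    assume "rep k = rep m"
    then show "exponent k - exponent m \<in> L"
      using trans_mem[OF minus_commute_mem[OF rep[of k]]] rep[of m] by simp
  next
    assume km: "exponent k - exponent m \<in> L"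
    have "exponent j - exponent k \<in> L \<longleftrightarrow> exponent j - exponent m \<in> L" for j
      using trans_mem[OF _ km] trans_mem[OF _ minus_commute_mem[OF km]] by blast
    then show "rep k = rep m" by (simp add: rep_def)
  qed
  let ?s = "\<lambda>f. \<Sum>m\<in>Poly_Mapping.keys p. scale (Poly_Mapping.lookup p m) (f m)"
  have "?s (\<lambda>m. monomial (rep m)) = 0"
  proof (rule poly_mapping_eqI)
    fix k
    have "Poly_Mapping.lookup (?s (\<lambda>m. monomial (rep m))) k
        = (\<Sum>m\<in>Poly_Mapping.keys p. Poly_Mapping.lookup p m * of_bool (rep m = k))"
      by (simp add: lookup_sum lookup_scale lookup_monomial)
    also have "\<dots> = 0"
    proof (cases "\<exists>m0. k = rep m0")
      case True
      then obtain m0 where "k = rep m0" ..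
      then show ?thesis
        using p[rule_format, of "exponent m0"]
        by (simp add: rep_eq_iff class_sum_def linear_extension_def)
    next
      case False
      then have "rep m \<noteq> k" for m by metis
      then show ?thesis by simp
    qed
    finally show "Poly_Mapping.lookup (?s (\<lambda>m. monomial (rep m))) k = Poly_Mapping.lookup 0 k" by simp
  qed
  then have "p = ?s (\<lambda>m. monomial m - monomial (rep m))"
    using monomial_expansion[of p] by (simp add: mpoly.scale_right_diff_distrib sum_subtractf)
  moreover have "?s (\<lambda>m. monomial m - monomial (rep m)) \<in> lattice_ideal L"
    unfolding lattice_ideal_def
    using rep minus_commute_mem by (intro mpoly.span_sum mpoly.span_scale mpoly.span_base) blast
  ultimately show "p \<in> lattice_ideal L" by simp
qed

lemma ideal_lattice_ideal: "ideal (lattice_ideal L) mpoly_ring"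
proof -
  have "class_sum L u (p * r) = 0" if "\<And>u. class_sum L u p = 0" for u p r
  proof (induction r rule: monomial_induct)
    case (monomial c m)
    have "p * scale c (monomial m) = scale c (p * monomial m)"
      by (simp add: scale_def mult.left_commute)
    then show ?case by (simp add: class_sum_linear class_sum_times_monomial that)
  qed (simp_all add: class_sum_linear distrib_left)
  then have "r * p \<in> lattice_ideal L" if "p \<in> lattice_ideal L" for p r
    unfolding mem_lattice_ideal_iff mult.commute[of r p]
    using that[unfolded mem_lattice_ideal_iff] by blast
  moreover have "p + q \<in> lattice_ideal L"
    if "p \<in> lattice_ideal L" "q \<in> lattice_ideal L" for p q
    using that by (simp add: lattice_ideal_def mpoly.span_add)
  moreover have "0 \<in> lattice_ideal L"
    by (simp add: lattice_ideal_def mpoly.span_zero)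
  ultimately show ?thesis
    unfolding ideal_mpoly_ring_iff by blast
qed

lemma monomial_diff_mem: "exponent k - exponent m \<in> L \<Longrightarrow> monomial k - monomial m \<in> lattice_ideal L"
  unfolding lattice_ideal_def by (rule mpoly.span_base) blast

text \<open>
  Multiplication by a monomial only translates the class sums, so it is injective.
\<close>

lemma monomial_regular:
  assumes "f * monomial d \<in> lattice_ideal L"
  shows "f \<in> lattice_ideal L"
  unfolding mem_lattice_ideal_iff
proof
  fix u
  have "class_sum L (u + exponent d) (f * monomial d) = 0"
    using assms by (simp add: mem_lattice_ideal_iff)
  then show "class_sum L u f = 0" by (simp add: class_sum_times_monomial)
qed


section \<open>The socle modulo a monomial\<close>

lemma residual_cong:
  assumes "u - u' \<in> L"
  shows "residual L d u \<longleftrightarrow> residual L d u'"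
proof -
  have "effective L x \<longleftrightarrow> effective L x'" if "x - x' \<in> L" for x x'
    unfolding effective_def
    using trans_mem[OF that] trans_mem[OF minus_commute_mem[OF that]] by blast
  then have "effective L u \<longleftrightarrow> effective L u'" "effective L (u - d) \<longleftrightarrow> effective L (u' - d)"
    using assms by simp_all
  then show ?thesis by (simp add: residual_def)
qed

lemma maximal_residual_cong:
  assumes "u - u' \<in> L"
  shows "maximal_residual L d u \<longleftrightarrow> maximal_residual L d u'"
proof -
  have "residual L d (u + v) \<longleftrightarrow> residual L d (u' + v)" for v
    by (rule residual_cong) (use assms in simp)
  then show ?thesis using residual_cong[OF assms] by (simp add: maximal_residual_def)
qed

lemma effective_exponent: "effective L (exponent m)"
  unfolding effective_def by (rule exI[of _ m]) (use zero_mem in \<open>simp add: zero_fun_def\<close>)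

lemma effective_add_exponent:
  assumes "effective L u"
  shows "effective L (u + exponent m)"
proof -
  obtain k where "u - exponent k \<in> L" using assms by (auto simp: effective_def)
  then have "u + exponent m - exponent (k + m) \<in> L" by (simp add: exponent_add)
  then show ?thesis unfolding effective_def ..
qed

lemma class_sum_nonzero_effective:
  assumes "class_sum L u p \<noteq> 0"
  shows "effective L u"
proof (rule ccontr)
  assume "\<not> effective L u"
  then have "exponent m - u \<notin> L" for m
    using minus_commute_mem unfolding effective_def by blast
  then show False using assms by (simp add: class_sum_def linear_extension_def)
qed

text \<open>
  Modulo the monomial with exponent \<open>d\<close>, exactly the monomials in nonresidual classes die. The remaining
  ones are independent because a multiple of this monomial has class sums only at classes \<open>u\<close> for
  which \<open>u - d\<close> is effective.
\<close>

lemma mem_add_monomial_iff: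
  "p \<in> lattice_ideal L <+>\<^bsub>mpoly_ring\<^esub> PIdl\<^bsub>mpoly_ring\<^esub> (monomial d) \<longleftrightarrow>
   (\<forall>u. residual L (exponent d) u \<longrightarrow> class_sum L u p = 0)" (is "p \<in> ?J \<longleftrightarrow> _")
proof -
  have J: "ideal ?J mpoly_ring" by (rule ideal_add_principal[OF ideal_lattice_ideal])
  have fwd: "class_sum L u p = 0" if "p \<in> ?J" "residual L (exponent d) u" for u p
  proof -
    obtain h where "p - h * monomial d \<in> lattice_ideal L"
      using \<open>p \<in> ?J\<close> by (auto simp: in_add_principal_iff)
    then have "class_sum L u p = class_sum L (u - exponent d) h"
      by (simp add: mem_lattice_ideal_iff class_sum_linear class_sum_times_monomial)
    then show ?thesis
      using that(2) class_sum_nonzero_effective[of "u - exponent d" h] by (auto simp: residual_def)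
  qed
  have "p \<in> ?J" if p: "\<And>u. residual L (exponent d) u \<Longrightarrow> class_sum L u p = 0"
  proof -
    let ?t = "\<lambda>m. scale (Poly_Mapping.lookup p m) (monomial m)"
    let ?R = "{m \<in> Poly_Mapping.keys p. residual L (exponent d) (exponent m)}"
    let ?N = "{m \<in> Poly_Mapping.keys p. \<not> residual L (exponent d) (exponent m)}"
    define n where "n = sum ?t ?N"
    define r where "r = sum ?t ?R"
    have split: "p = n + r"
    proof -
      have "n + r = sum ?t (?N \<union> ?R)"
        unfolding n_def r_def by (rule sum.union_disjoint[symmetric]) auto
      also have "?N \<union> ?R = Poly_Mapping.keys p" by auto
      also have "sum ?t (Poly_Mapping.keys p) = p" by (rule monomial_expansion[symmetric])
      finally show ?thesis ..
    qed
    have "monomial m \<in> ?J" if "\<not> residual L (exponent d) (exponent m)" for m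
    proof -
      obtain k where "exponent m - exponent d - exponent k \<in> L"
        using \<open>\<not> residual L (exponent d) (exponent m)\<close> effective_exponent[of m]
        unfolding residual_def effective_def[of L "exponent m - exponent d"] by blast
      then have "exponent m - exponent (k + d) \<in> L"
        by (simp add: exponent_add algebra_simps)
      from monomial_diff_mem[OF this] show ?thesis
        unfolding in_add_principal_iff monomial_add by blast
    qed
    then have N: "n \<in> ?J"
      unfolding n_def by (intro mpoly.subspace_sum[OF subspace_ideal[OF J]] ideal_scale[OF J]) auto
    have "class_sum L u r = 0" for u
    proof (cases "residual L (exponent d) u")
      case True
      have "class_sum L u r = class_sum L u p - class_sum L u n"
        by (simp add: split class_sum_linear)
      then show ?thesis using p[OF True] fwd[OF N True] by simp
    next
      case False
      then have "class_sum L u (monomial m) = 0" if "m \<in> ?R" for m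
        using that residual_cong[of "exponent m" u "exponent d"] by (auto simp: class_sum_monomial)
      then show ?thesis by (auto simp: r_def class_sum_linear intro!: sum.neutral)
    qed
    then have "r \<in> lattice_ideal L" by (simp add: mem_lattice_ideal_iff)
    then have "r \<in> ?J"
      unfolding in_add_principal_iff by (intro exI[of _ 0]) simp
    with N show ?thesis unfolding split by (rule ideal_add[OF J])
  qed
  with fwd show ?thesis by blast
qed

lemma colon_add_monomial_iff:
  "p \<in> colon_irrelevant (lattice_ideal L <+>\<^bsub>mpoly_ring\<^esub> PIdl\<^bsub>mpoly_ring\<^esub> (monomial d)) \<longleftrightarrow>
   (\<forall>u v. residual L (exponent d) (u + vertex_divisor v) \<longrightarrow> class_sum L u p = 0)"
proof -
  have "(\<forall>u. residual L (exponent d) u \<longrightarrow> class_sum L u (p * Var v) = 0) \<longleftrightarrow>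
      (\<forall>u. residual L (exponent d) (u + vertex_divisor v) \<longrightarrow> class_sum L u p = 0)" for v
  proof -
    have "class_sum L u (p * Var v) = class_sum L (u - vertex_divisor v) p" for u
      unfolding Var_def class_sum_times_monomial exponent_single ..
    then show ?thesis by (metis add_diff_cancel_right' diff_add_cancel)
  qed
  then show ?thesis
    unfolding colon_irrelevant_iff[OF ideal_add_principal[OF ideal_lattice_ideal]] mem_add_monomial_iff
    by blast
qed

text \<open>
  The quotient has the residual classes as a basis and is graded by them, and multiplication by a
  variable sends a basis element to a basis element or to zero. So its socle is spanned by the
  maximal residual classes, and its dimension is their number.
\<close>

lemma one_dimensional_socle_monomial_iff:
  "one_dimensional_socle (lattice_ideal L <+>\<^bsub>mpoly_ring\<^esub> PIdl\<^bsub>mpoly_ring\<^esub> (monomial d)) \<longleftrightarrow>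
   (\<exists>u. maximal_residual L (exponent d) u \<and>
        (\<forall>u'. maximal_residual L (exponent d) u' \<longrightarrow> u' - u \<in> L))" (is "one_dimensional_socle ?J \<longleftrightarrow> _")
proof
  have J: "ideal ?J mpoly_ring" by (rule ideal_add_principal[OF ideal_lattice_ideal])
  have colon_max: "monomial m \<in> colon_irrelevant ?J" if "maximal_residual L (exponent d) (exponent m)" for m
    unfolding colon_add_monomial_iff class_sum_monomial
  proof (intro allI impI)
    fix u v assume "residual L (exponent d) (u + vertex_divisor v)"
    then have "\<not> maximal_residual L (exponent d) u" by (auto simp: maximal_residual_def)
    then show "of_bool (exponent m - u \<in> L) = (0 :: complex)"
      using that maximal_residual_cong[of "exponent m" u] by auto
  qed
  have ex_monomial: "\<exists>m. exponent m - u \<in> L" if "maximal_residual L (exponent d) u" for u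
    using that minus_commute_mem by (auto simp: maximal_residual_def residual_def effective_def)
  {
    assume "one_dimensional_socle ?J"
    then obtain q where q: "q \<in> colon_irrelevant ?J" "q \<notin> ?J"
        and gen: "\<And>p. p \<in> colon_irrelevant ?J \<Longrightarrow> \<exists>c. p - scale c q \<in> ?J"
      unfolding one_dimensional_socle_def by blast
    obtain u where u: "residual L (exponent d) u" "class_sum L u q \<noteq> 0"
      using q(2) by (auto simp: mem_add_monomial_iff)
    then have max: "maximal_residual L (exponent d) u"
      using q(1) by (auto simp: maximal_residual_def colon_add_monomial_iff)
    have "u' - u \<in> L" if max': "maximal_residual L (exponent d) u'" for u'
    proof (rule ccontr)
      assume "u' - u \<notin> L"
      obtain m where m: "exponent m - u' \<in> L" using ex_monomial[OF max'] by blast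
      have mu: "exponent m - u \<notin> L"
        using \<open>u' - u \<notin> L\<close> trans_mem[OF minus_commute_mem[OF m]] by blast
      have "monomial m \<in> colon_irrelevant ?J"
        using colon_max max' maximal_residual_cong[OF m] by blast
      then obtain c where c: "monomial m - scale c q \<in> ?J" using gen by blast
      have "class_sum L u (monomial m - scale c q) = 0"
        using c u(1) by (simp add: mem_add_monomial_iff)
      then have "c = 0" using mu u(2) by (simp add: class_sum_linear class_sum_monomial)
      moreover have "class_sum L u' (monomial m - scale c q) = 0"
        using c max' by (simp add: mem_add_monomial_iff maximal_residual_def)
      ultimately show False using m by (simp add: class_sum_linear class_sum_monomial)
    qed
    then show "\<exists>u. maximal_residual L (exponent d) u \<and>
        (\<forall>u'. maximal_residual L (exponent d) u' \<longrightarrow> u' - u \<in> L)"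
      using max by blast
  next
    assume "\<exists>u. maximal_residual L (exponent d) u \<and>
        (\<forall>u'. maximal_residual L (exponent d) u' \<longrightarrow> u' - u \<in> L)"
    then obtain u where u: "maximal_residual L (exponent d) u"
        and uniq: "\<And>u'. maximal_residual L (exponent d) u' \<Longrightarrow> u' - u \<in> L" by blast
    obtain m where m: "exponent m - u \<in> L" using ex_monomial[OF u] by blast
    have q: "monomial m \<in> colon_irrelevant ?J"
      using colon_max u maximal_residual_cong[OF m] by blast
    moreover have "monomial m \<notin> ?J"
      using u m unfolding mem_add_monomial_iff class_sum_monomial maximal_residual_def by force
    moreover have "p - scale (class_sum L u p) (monomial m) \<in> ?J" if p: "p \<in> colon_irrelevant ?J" for p
      unfolding mem_add_monomial_iff
    proof (intro allI impI)
      fix u' assume res: "residual L (exponent d) u'"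
      show "class_sum L u' (p - scale (class_sum L u p) (monomial m)) = 0"
      proof (cases "maximal_residual L (exponent d) u'")
        case True
        note mem = uniq[OF True]
        have "class_sum L u' (monomial m) = class_sum L u (monomial m)" "class_sum L u' p = class_sum L u p"
          by (rule class_sum_cong[OF mem])+
        then show ?thesis using m by (simp add: class_sum_linear class_sum_monomial)
      next
        case False
        then obtain v where "residual L (exponent d) (u' + vertex_divisor v)"
          using res by (auto simp: maximal_residual_def)
        then have "class_sum L u' p = 0" "class_sum L u' (monomial m) = 0"
          using p q unfolding colon_add_monomial_iff by blast+
        then show ?thesis by (simp add: class_sum_linear)
      qed
    qed
    ultimately show "one_dimensional_socle ?J" unfolding one_dimensional_socle_def by blast
  }
qed

end

section \<open>Elements of finite codimension are regular\<close>

text \<open>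
  A sequence of polynomials modulo a subspace of finite codimension has a term that depends on the
  previous ones. The induction on the spanning set of the quotient is Gaussian elimination: a term
  with a nonzero coefficient at the new spanning vector is used to clear this coefficient from all later
  terms. Stating the result for a single late term keeps the leading coefficient 1, which the
  degree argument below relies on.
\<close>

lemma finite_codimension_dependence:
  fixes J :: "'v mpoly set" and f :: "nat \<Rightarrow> 'v mpoly"
  assumes "finite F" "mpoly.subspace J" "\<And>i. \<exists>e\<in>mpoly.span F. f i - e \<in> J"
  shows "\<exists>n. f n \<in> mpoly.span (f ` {..<n} \<union> J)"
  using assms(1,3)
proof (induction F arbitrary: f)
  case empty
  then have "f 0 \<in> J" by simp
  then show ?case by (intro exI[of _ 0]) (simp add: mpoly.span_base)
next
  case (insert b F)
  have "\<exists>c e. e \<in> mpoly.span F \<and> f i - (scale c b + e) \<in> J" for i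
    using insert.prems[of i] unfolding span_insert_eq by blast
  then obtain c e where e: "\<And>i. e i \<in> mpoly.span F" and J: "\<And>i. f i - (scale (c i) b + e i) \<in> J"
    by metis
  show ?case
  proof (cases "\<forall>i. c i = 0")
    case True
    then have "\<exists>e\<in>mpoly.span F. f i - e \<in> J" for i
      using e[of i] J[of i] by auto
    then show ?thesis by (rule insert.IH)
  next
    case False
    then obtain k where k: "c k \<noteq> 0" by blast
    define t where "t i = c (Suc k + i) / c k" for i
    define g where "g i = f (Suc k + i) - scale (t i) (f k)" for i
    have "\<exists>e\<in>mpoly.span F. g i - e \<in> J" for i
    proof
      let ?e = "e (Suc k + i) - scale (t i) (e k)"
      show "?e \<in> mpoly.span F" by (intro mpoly.span_diff mpoly.span_scale e)
      have tk: "scale (t i) (scale (c k) b) = scale (c (Suc k + i)) b"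
        using k by (simp add: t_def)
      have "g i - ?e = (f (Suc k + i) - (scale (c (Suc k + i)) b + e (Suc k + i)))
          - scale (t i) (f k - (scale (c k) b + e k))"
        by (simp only: g_def mpoly.scale_right_diff_distrib mpoly.scale_right_distrib tk) simp
      then show "g i - ?e \<in> J"
        using mpoly.subspace_diff[OF assms(2) J mpoly.subspace_scale[OF assms(2) J]] by metis
    qed
    then obtain n where n: "g n \<in> mpoly.span (g ` {..<n} \<union> J)" using insert.IH by blast
    let ?S = "mpoly.span (f ` {..<Suc k + n} \<union> J)"
    have f: "f i \<in> ?S" if "i < Suc k + n" for i
      by (rule mpoly.span_base) (use that in blast)
    have "g ` {..<n} \<union> J \<subseteq> ?S"
      using f by (auto simp: g_def intro!: mpoly.span_diff mpoly.span_scale intro: mpoly.span_base)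
    then have "g n \<in> ?S" using n by (metis mpoly.span_minimal mpoly.subspace_span subsetD)
    moreover have "f (Suc k + n) = g n + scale (t n) (f k)" by (simp add: g_def)
    ultimately have "f (Suc k + n) \<in> ?S" using f[of k] by (simp add: mpoly.span_add mpoly.span_scale)
    then show ?thesis ..
  qed
qed

context degree_zero_lattice
begin

text \<open>
  For a vertex \<open>s\<close>, finite codimension yields a monic polynomial in the variable of \<open>s\<close> that is a multiple
  of \<open>a\<close> modulo the lattice ideal. Such a polynomial is regular: multiplying it with a nonzero \<open>f\<close>, the
  top-degree part of \<open>f\<close> times the leading power cannot cancel, since the lattice lies in degree zero and
  the quotient is therefore graded by degree. Whatever \<open>a\<close> annihilates is annihilated by its
  multiples, so \<open>a\<close> is regular, too.
\<close>

lemma regular_if_finite_codimension: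
  assumes F: "finite F"
      "\<And>p. \<exists>e\<in>mpoly.span F. p - e \<in> lattice_ideal L <+>\<^bsub>mpoly_ring\<^esub> PIdl\<^bsub>mpoly_ring\<^esub> a"
    and fa: "f * a \<in> lattice_ideal L"
  shows "f \<in> lattice_ideal L"
proof (rule ccontr)
  let ?I = "lattice_ideal L" and ?J = "lattice_ideal L <+>\<^bsub>mpoly_ring\<^esub> PIdl\<^bsub>mpoly_ring\<^esub> a"
  fix s :: 'v
  define x where "x i = monomial (Poly_Mapping.single s i)" for i
  have J: "mpoly.subspace ?J"
    by (rule subspace_ideal[OF ideal_add_principal[OF ideal_lattice_ideal]])
  obtain n where "x n \<in> mpoly.span (x ` {..<n} \<union> ?J)"
    using finite_codimension_dependence[OF F(1) J, of x] F(2) by blast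
  then obtain r j where r: "r \<in> mpoly.span (x ` {..<n})" and "j \<in> mpoly.span ?J" and xn: "x n = r + j"
    unfolding mpoly.span_Un by blast
  then have "j \<in> ?J" using mpoly.span_minimal[OF subset_refl J] by blast
  then obtain h where h: "j - h * a \<in> ?I" unfolding in_add_principal_iff ..
  have "f * (j - h * a) + h * (f * a) \<in> ?I"
    by (rule ideal_add[OF ideal_lattice_ideal ideal_mult[OF ideal_lattice_ideal h] ideal_mult[OF ideal_lattice_ideal fa]])
  then have fj: "f * j \<in> ?I" by (simp add: algebra_simps)
  assume "f \<notin> ?I"
  \<comment> \<open>The degrees that occur in \<open>f\<close> modulo the ideal; \<open>f\<close> is nonzero there, so they have a maximum.\<close>
  define D where "D = {degree u | u. class_sum L u f \<noteq> 0}"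
  have "D \<subseteq> (\<lambda>m. degree (exponent m)) ` Poly_Mapping.keys f"
  proof safe
    fix t assume "t \<in> D"
    then obtain u where u: "t = degree u" "class_sum L u f \<noteq> 0" by (auto simp: D_def)
    obtain m where m: "m \<in> Poly_Mapping.keys f" "exponent m - u \<in> L"
    proof (rule ccontr)
      assume "\<not> thesis"
      then have "\<forall>m\<in>Poly_Mapping.keys f. exponent m - u \<notin> L" using that by blast
      then show False using u(2) by (simp add: class_sum_def linear_extension_def)
    qed
    then have "degree (exponent m) = t" using degree_mem[OF m(2)] u(1) by (simp add: degree_diff)
    then show "t \<in> (\<lambda>m. degree (exponent m)) ` Poly_Mapping.keys f" using m(1) by blast
  qed
  then have "finite D" by (rule finite_subset) simp
  moreover have "D \<noteq> {}" using \<open>f \<notin> ?I\<close> by (auto simp: D_def mem_lattice_ideal_iff)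
  ultimately have "Max D \<in> D" and le: "\<And>t. t \<in> D \<Longrightarrow> t \<le> Max D" by simp_all
  then obtain u where u: "degree u = Max D" "class_sum L u f \<noteq> 0" by (auto simp: D_def)
  have deg: "degree (exponent (Poly_Mapping.single s i)) = int i" for i
    by (simp add: degree_def exponent_def lookup_single when_def if_distrib[of int] cong: if_cong)
  let ?u = "u + exponent (Poly_Mapping.single s n)"
  have "class_sum L ?u (f * r) = 0"
    using r
  proof (induction rule: mpoly.span_induct)
    case base
    show ?case
    proof (rule mpoly.subspaceI)
      fix c p assume "p \<in> {p. class_sum L ?u (f * p) = 0}"
      moreover have "f * scale c p = scale c (f * p)" by (simp add: scale_def mult.left_commute)
      ultimately show "scale c p \<in> {p. class_sum L ?u (f * p) = 0}" by (simp add: class_sum_linear)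
    qed (simp_all add: class_sum_linear distrib_left)
  next
    case (step y)
    then obtain i where i: "i < n" "y = x i" by blast
    have "degree (?u - exponent (Poly_Mapping.single s i)) > Max D"
      using i(1) by (simp only: degree_diff degree_add deg u(1))
    then have "class_sum L (?u - exponent (Poly_Mapping.single s i)) f = 0"
      using le unfolding D_def by force
    then show ?case by (simp only: i(2) x_def class_sum_times_monomial)
  qed
  moreover have "class_sum L ?u (f * j) = 0" using fj by (simp add: mem_lattice_ideal_iff)
  moreover have "class_sum L ?u (f * x n) = class_sum L u f"
    by (simp only: x_def class_sum_times_monomial add_diff_cancel_right')
  ultimately show False using u(2) by (simp add: xn distrib_left class_sum_linear)
qed

text \<open>
  Subtracting \<open>d\<close> as often as the class stays effective ends in a residual class, as effective
  divisors have nonnegative degree.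
\<close>

lemma ex_residual:
  assumes "effective L u" and d: "degree d > 0"
  shows "\<exists>j::nat. residual L d (u - (\<lambda>i. int j * d i))"
proof -
  let ?v = "\<lambda>j::nat. u - (\<lambda>i. int j * d i)"
  have deg: "degree (?v j) = degree u - int j * degree d" for j
    by (simp add: degree_def sum_subtractf sum_distrib_left)
  have "\<not> effective L (?v (nat (degree u) + 1))"
  proof
    assume "effective L (?v (nat (degree u) + 1))"
    then obtain m where "?v (nat (degree u) + 1) - exponent m \<in> L" by (auto simp: effective_def)
    from degree_mem[OF this] have "degree (?v (nat (degree u) + 1)) \<ge> 0"
      using degree_exponent_nonneg[of m] by (simp only: degree_diff)
    moreover have "int (nat (degree u) + 1) * degree d \<ge> int (nat (degree u) + 1)"
      using mult_left_mono[of 1 "degree d" "int (nat (degree u) + 1)"] d by simp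
    ultimately show False unfolding deg by linarith
  qed
  moreover have "effective L (?v 0)"
  proof -
    have "?v 0 = u" by (simp add: fun_eq_iff)
    then show ?thesis using assms(1) by metis
  qed
  ultimately obtain j where j: "effective L (?v j)" "\<not> effective L (?v (Suc j))"
    using ex_least_nat_less[where P = "\<lambda>j. \<not> effective L (?v j)"] by (meson order_refl)
  have "?v (Suc j) = ?v j - d" by (simp add: fun_eq_iff algebra_simps)
  then show ?thesis using j unfolding residual_def by metis
qed

end

lemma degree_exponent_pos:
  assumes "d \<noteq> 0"
  shows "degree (exponent d) > 0"
proof -
  obtain v where "Poly_Mapping.lookup d v \<noteq> 0"
    using assms by (metis poly_mapping_eqI lookup_zero)
  then have "0 < exponent d v" by (simp add: exponent_def)
  also have "\<dots> \<le> degree (exponent d)"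
    unfolding degree_def by (rule member_le_sum) (simp_all add: exponent_def)
  finally show ?thesis .
qed

section \<open>Gluing two lattices along a pair of effective divisors\<close>

abbreviation join :: "('a \<Rightarrow> int) \<Rightarrow> ('b \<Rightarrow> int) \<Rightarrow> 'a + 'b \<Rightarrow> int" where
  "join \<equiv> case_sum"

lemma join_arith:
  "join x y + join x' y' = join (x + x') (y + y')"
  "join x y - join x' y' = join (x - x') (y - y')"
  by (auto simp: fun_eq_iff split: sum.splits)

lemma vertex_divisor_sum:
  "vertex_divisor (Inl v) = join (vertex_divisor v) 0"
  "vertex_divisor (Inr w) = join 0 (vertex_divisor w)"
  by (auto simp: fun_eq_iff vertex_divisor_def split: sum.splits)

text \<open>
  The lattice generated by \<open>L1\<close>, \<open>L2\<close> and the difference of the effective divisors \<open>d\<close> on the first and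
  \<open>e\<close> on the second vertex set. Its lattice ideal is generated by those of \<open>L1\<close> and \<open>L2\<close> together with
  the binomial of \<open>d\<close> and \<open>e\<close>, so that the quotient is the tensor product of the two quotients modulo a
  regular element. The lemmas express this by classes: a divisor class for \<open>L\<close> is a pair of
  classes up to trading copies of \<open>d\<close> for copies of \<open>e\<close>.
\<close>

locale glued_lattices =
  L1: degree_zero_lattice L1 + L2: degree_zero_lattice L2 + L: degree_zero_lattice L
  for L1 :: "('a::finite \<Rightarrow> int) set" and L2 :: "('b::finite \<Rightarrow> int) set" and L :: "('a + 'b \<Rightarrow> int) set" +
  fixes d :: "'a \<Rightarrow>\<^sub>0 nat" and e :: "'b \<Rightarrow>\<^sub>0 nat"
  assumes d_nonzero: "d \<noteq> 0" and e_nonzero: "e \<noteq> 0"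
    and join_mem_iff: "join x y \<in> L \<longleftrightarrow>
      (\<exists>k::int. x - (\<lambda>i. k * exponent d i) \<in> L1 \<and> y + (\<lambda>i. k * exponent e i) \<in> L2)"
begin

abbreviation (input) dd :: "int \<Rightarrow> 'a \<Rightarrow> int" where "dd k \<equiv> (\<lambda>i. k * exponent d i)"
abbreviation (input) ee :: "int \<Rightarrow> 'b \<Rightarrow> int" where "ee k \<equiv> (\<lambda>i. k * exponent e i)"

lemma effective_join_iff:
  "effective L (join x y) \<longleftrightarrow> (\<exists>k. effective L1 (x - dd k) \<and> effective L2 (y + ee k))"
proof
  assume "effective L (join x y)"
  then obtain m where m: "join x y - exponent m \<in> L" by (auto simp: effective_def)
  obtain m1 where m1: "exponent m1 = exponent m \<circ> Inl" by (rule ex_exponent[of "exponent m \<circ> Inl"]) (simp add: exponent_def)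
  obtain m2 where m2: "exponent m2 = exponent m \<circ> Inr" by (rule ex_exponent[of "exponent m \<circ> Inr"]) (simp add: exponent_def)
  have "exponent m = join (exponent m1) (exponent m2)"
    by (auto simp: fun_eq_iff m1 m2 split: sum.splits)
  with m obtain k where "x - exponent m1 - dd k \<in> L1" "y - exponent m2 + ee k \<in> L2"
    by (auto simp: join_arith join_mem_iff)
  moreover have "x - exponent m1 - dd k = x - dd k - exponent m1" "y - exponent m2 + ee k = y + ee k - exponent m2"
    by (simp_all add: fun_eq_iff)
  ultimately show "\<exists>k. effective L1 (x - dd k) \<and> effective L2 (y + ee k)"
    unfolding effective_def by metis
next
  assume "\<exists>k. effective L1 (x - dd k) \<and> effective L2 (y + ee k)"
  then obtain k m1 m2 where k: "x - dd k - exponent m1 \<in> L1" "y + ee k - exponent m2 \<in> L2"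
    by (auto simp: effective_def)
  obtain m where m: "exponent m = join (exponent m1) (exponent m2)"
    by (rule ex_exponent[of "join (exponent m1) (exponent m2)"]) (simp add: exponent_def split: sum.splits)
  have "x - dd k - exponent m1 = x - exponent m1 - dd k" "y + ee k - exponent m2 = y - exponent m2 + ee k"
    by (simp_all add: fun_eq_iff)
  with k have "join x y - exponent m \<in> L"
    unfolding m join_arith join_mem_iff by metis
  then show "effective L (join x y)" unfolding effective_def ..
qed

lemma effective1_add: "effective L1 x \<Longrightarrow> k \<ge> 0 \<Longrightarrow> effective L1 (x + dd k)"
proof -
  assume "effective L1 x" "k \<ge> 0"
  moreover from \<open>k \<ge> 0\<close> obtain m where "exponent m = dd k"
    using ex_exponent[of "dd k"] by (auto simp: exponent_def)
  ultimately show ?thesis using L1.effective_add_exponent by metis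
qed

lemma effective2_add: "effective L2 y \<Longrightarrow> k \<ge> 0 \<Longrightarrow> effective L2 (y + ee k)"
proof -
  assume "effective L2 y" "k \<ge> 0"
  moreover from \<open>k \<ge> 0\<close> obtain m where "exponent m = ee k"
    using ex_exponent[of "ee k"] by (auto simp: exponent_def)
  ultimately show ?thesis using L2.effective_add_exponent by metis
qed

text \<open>
  If the first component is residual with respect to \<open>d\<close>, no copy of \<open>d\<close> can be traded for one of \<open>e\<close>,
  and trading in the other direction only takes copies of \<open>e\<close> away from the second component.
\<close>

lemma effective_join_residual:
  assumes "residual L1 (exponent d) x"
  shows "effective L (join x y) \<longleftrightarrow> effective L2 y"
proof
  assume "effective L (join x y)"
  then obtain k where k: "effective L1 (x - dd k)" "effective L2 (y + ee k)"
    by (auto simp: effective_join_iff)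
  have "k \<le> 0"
  proof (rule ccontr)
    assume "\<not> k \<le> 0"
    then have "k - 1 \<ge> 0" by simp
    then have "effective L1 (x - dd k + dd (k - 1))" by (rule effective1_add[OF k(1)])
    moreover have "x - dd k + dd (k - 1) = x - exponent d" by (simp add: fun_eq_iff algebra_simps)
    ultimately show False using assms unfolding residual_def by metis
  qed
  then have "- k \<ge> 0" by simp
  then have "effective L2 (y + ee k + ee (- k))" by (rule effective2_add[OF k(2)])
  also have "y + ee k + ee (- k) = y" by (simp add: fun_eq_iff)
  finally show "effective L2 y" .
next
  assume "effective L2 y"
  moreover have "x - dd 0 = x" "y + ee 0 = y" by (simp_all add: fun_eq_iff)
  ultimately show "effective L (join x y)"
    using assms unfolding effective_join_iff residual_def by metis
qed

lemma residual_join_residual: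
  assumes "residual L1 (exponent d) x"
  shows "residual L (join 0 c) (join x y) \<longleftrightarrow> residual L2 c y"
  by (simp add: residual_def join_arith effective_join_residual[OF assms])

text \<open>
  Pairs with residual first component represent the residual classes of \<open>L\<close> as a product of two posets,
  so maximality should be tested componentwise. The point that needs an argument is a step in the
  first component that leaves the residual classes of \<open>L1\<close>: it frees a copy of \<open>d\<close>, which is traded
  for \<open>e\<close>, and since \<open>e\<close> is nonzero and the second component is maximal, the result is not residual.
\<close>

lemma maximal_residual_join:
  assumes x: "residual L1 (exponent d) x"
  shows "maximal_residual L (join 0 c) (join x y) \<longleftrightarrow>
    maximal_residual L1 (exponent d) x \<and> maximal_residual L2 c y" (is "?max \<longleftrightarrow> _")
proof
  assume max: ?max
  then have y: "residual L2 c y" by (simp add: maximal_residual_def residual_join_residual[OF x])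
  have no: "\<not> residual L (join 0 c) (join x y + vertex_divisor w)" for w
    using max by (simp add: maximal_residual_def)
  have "\<not> residual L2 c (y + vertex_divisor v)" for v
    using no[of "Inr v"] by (simp add: vertex_divisor_sum join_arith residual_join_residual[OF x])
  moreover have "\<not> residual L1 (exponent d) (x + vertex_divisor v)" for v
    using no[of "Inl v"] y residual_join_residual[of "x + vertex_divisor v" c y]
    by (auto simp: vertex_divisor_sum join_arith)
  ultimately show "maximal_residual L1 (exponent d) x \<and> maximal_residual L2 c y"
    using x y by (simp add: maximal_residual_def)
next
  assume max: "maximal_residual L1 (exponent d) x \<and> maximal_residual L2 c y"
  then have y: "residual L2 c y" by (simp add: maximal_residual_def)
  have y_step: "effective L2 (y + vertex_divisor v - c)" for v
    using max L2.effective_add_exponent[of y "Poly_Mapping.single v 1"]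
    unfolding exponent_single maximal_residual_def residual_def by blast
  have x_step: "effective L1 (x + vertex_divisor v - exponent d)" for v
    using max L1.effective_add_exponent[of x "Poly_Mapping.single v 1"]
    unfolding exponent_single maximal_residual_def residual_def by blast
  have "effective L2 (y + exponent e - c)"
  proof -
    obtain v where v: "Poly_Mapping.lookup e v \<noteq> 0"
      using e_nonzero by (metis poly_mapping_eqI lookup_zero)
    have "e = (e - Poly_Mapping.single v 1) + Poly_Mapping.single v 1"
      by (rule split_off_variable) (use v in simp)
    then have "exponent e = exponent (e - Poly_Mapping.single v 1) + vertex_divisor v"
      by (metis exponent_add exponent_single)
    then have "y + exponent e - c = y + vertex_divisor v - c + exponent (e - Poly_Mapping.single v 1)"
      by (simp add: fun_eq_iff)
    then show ?thesis using L2.effective_add_exponent[OF y_step] by metis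
  qed
  then have "effective L (join (x + vertex_divisor v) (y - c))" for v
    unfolding effective_join_iff
    using x_step[of v] by (intro exI[of _ 1]) (simp add: algebra_simps)
  then have "\<not> residual L (join 0 c) (join x y + vertex_divisor (Inl v))" for v
    by (simp add: vertex_divisor_sum join_arith residual_def)
  moreover have "\<not> residual L (join 0 c) (join x y + vertex_divisor (Inr v))" for v
    using max by (simp add: vertex_divisor_sum join_arith residual_join_residual[OF x] maximal_residual_def)
  ultimately have "\<not> residual L (join 0 c) (join x y + vertex_divisor w)" for w
    by (cases w) auto
  then show ?max using y by (simp add: maximal_residual_def residual_join_residual[OF x])
qed

text \<open>
  Trading all available copies of \<open>d\<close> makes the first component residual.
\<close>

lemma ex_residual_join:
  assumes "effective L w"
  obtains x y where "residual L1 (exponent d) x" "w - join x y \<in> L"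
proof -
  define a b where "a = w \<circ> Inl" and "b = w \<circ> Inr"
  have w: "w = join a b" by (auto simp: a_def b_def fun_eq_iff split: sum.splits)
  obtain k where "effective L1 (a - dd k)" using assms by (auto simp: w effective_join_iff)
  then obtain j :: nat where j: "residual L1 (exponent d) (a - dd k - dd (int j))"
    using L1.ex_residual degree_exponent_pos[OF d_nonzero] by blast
  let ?x = "a - dd k - dd (int j)" and ?y = "b + ee (k + int j)"
  have "a - ?x - dd (k + int j) = 0" "b - ?y + ee (k + int j) = 0"
    by (simp_all add: fun_eq_iff algebra_simps)
  then have "w - join ?x ?y \<in> L"
    unfolding w join_arith join_mem_iff using L1.zero_mem L2.zero_mem by metis
  with j show thesis by (rule that)
qed

lemma unique_maximal_residual:
  assumes u1: "maximal_residual L1 (exponent d) u1"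
      "\<And>u. maximal_residual L1 (exponent d) u \<Longrightarrow> u - u1 \<in> L1"
    and u2: "maximal_residual L2 c u2"
      "\<And>u. maximal_residual L2 c u \<Longrightarrow> u - u2 \<in> L2"
  shows "maximal_residual L (join 0 c) (join u1 u2)"
    and "maximal_residual L (join 0 c) w \<Longrightarrow> w - join u1 u2 \<in> L"
proof -
  have "residual L1 (exponent d) u1" using u1(1) by (simp add: maximal_residual_def)
  then show "maximal_residual L (join 0 c) (join u1 u2)"
    using maximal_residual_join u1(1) u2(1) by blast
  assume w: "maximal_residual L (join 0 c) w"
  then have "effective L w" by (simp add: maximal_residual_def residual_def)
  then obtain x y where x: "residual L1 (exponent d) x" and xy: "w - join x y \<in> L"
    by (rule ex_residual_join)
  have "maximal_residual L (join 0 c) (join x y)" using w L.maximal_residual_cong[OF xy] by blast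
  then have "x - u1 \<in> L1" "y - u2 \<in> L2"
    using maximal_residual_join[OF x] u1(2) u2(2) by blast+
  moreover have "x - u1 - dd 0 = x - u1" "y - u2 + ee 0 = y - u2" by (simp_all add: fun_eq_iff)
  ultimately have "join x y - join u1 u2 \<in> L"
    unfolding join_arith join_mem_iff by metis
  with xy show "w - join u1 u2 \<in> L" by (rule L.trans_mem)
qed

end

section \<open>The Laplacian lattice of a wiring\<close>

lemma laplacian_diff: "laplacian wt (D - D') = laplacian wt D - laplacian wt D'"
  by (simp add: laplacian_def fun_eq_iff left_diff_distrib sum_subtractf)

lemma laplacian_scale: "laplacian wt (\<lambda>v. k * D v) = (\<lambda>w. k * laplacian wt D w)"
  by (simp add: laplacian_def fun_eq_iff sum_distrib_left mult.assoc)

lemma laplacian_vertex_divisor: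
  "laplacian wt (vertex_divisor v) w = int (outdeg wt v) * vertex_divisor v w - int (wt v w)"
proof -
  have "laplacian wt (vertex_divisor v) w =
      (\<Sum>x\<in>UNIV. if x = v then int (outdeg wt x) * vertex_divisor x w - int (wt x w) else 0)"
    unfolding laplacian_def by (rule sum.cong) (auto simp: vertex_divisor_def)
  then show ?thesis by simp
qed

lemma degree_laplacian: "degree (laplacian wt D) = 0"
proof -
  have "(\<Sum>w\<in>UNIV. int (outdeg wt v) * vertex_divisor v w - int (wt v w)) = 0" for v
    using degree_vertex_divisor[of v]
    by (simp add: sum_subtractf sum_distrib_left[symmetric] degree_def outdeg_def)
  then show ?thesis
    unfolding degree_def laplacian_def
    by (subst sum.swap) (simp add: sum_distrib_left[symmetric])
qed

text \<open>
  Toppling a vertex moves chips without creating or destroying any.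
\<close>

lemma degree_zero_lattice_laplacian: "degree_zero_lattice (range (laplacian wt))"
proof
  show "0 \<in> range (laplacian wt)"
    by (rule range_eqI[of _ _ 0]) (simp add: laplacian_def fun_eq_iff)
  show "x - y \<in> range (laplacian wt)" if "x \<in> range (laplacian wt)" "y \<in> range (laplacian wt)" for x y
    using that by (auto simp flip: laplacian_diff)
  show "degree x = 0" if "x \<in> range (laplacian wt)" for x
    using that degree_laplacian by auto
qed

lemma absolute_sink_weight:
  assumes "absolute_sink wt s"
  shows "wt s v = 0"
  using assms by (simp add: absolute_sink_def outdeg_def)

text \<open>
  The images of the vertices other than \<open>s1\<close> are those of the two separate graphs, as the row of an
  absolute sink contributes nothing. The image of \<open>s1\<close> is the wiring divisor minus the divisor of
  its edges into the second graph. Replacing the wiring divisor by an effective divisor linearly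
  equivalent to it on the first graph does not change the lattice.
\<close>

lemma glued_lattices_wiring:
  fixes wt1 :: "'a::finite \<Rightarrow> 'a \<Rightarrow> nat" and wt2 :: "'b::finite \<Rightarrow> 'b \<Rightarrow> nat"
  assumes sink: "absolute_sink wt1 s1" and wiring: "wiring wt1 s1 wt2 s2 wt"
  obtains d e where "glued_lattices (range (laplacian wt1)) (range (laplacian wt2)) (range (laplacian wt)) d e"
proof -
  define W where "W = wiring_divisor s1 wt"
  from wiring have wt1: "\<And>u v. u \<noteq> s1 \<Longrightarrow> wt (Inl u) (Inl v) = wt1 u v"
    and wt2: "\<And>u v. wt (Inr u) (Inr v) = wt2 u v"
    and wt12: "\<And>u v. u \<noteq> s1 \<Longrightarrow> wt (Inl u) (Inr v) = 0"
    and wt21: "\<And>u v. wt (Inr u) (Inl v) = 0"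
    and nontrivial: "\<exists>v. wt (Inl s1) (Inr v) > 0"
    and system: "complete_linear_system wt1 W \<noteq> {}"
    by (simp_all add: wiring_def W_def)
  have W: "W w = int (outdeg wt (Inl s1)) * vertex_divisor s1 w - int (wt (Inl s1) (Inl w))" for w
    unfolding W_def wiring_divisor_def laplacian_vertex_divisor by (simp add: vertex_divisor_def)
  obtain D where D: "\<And>v. D v \<ge> 0" "D - W \<in> range (laplacian wt1)"
    using system unfolding complete_linear_system_def linearly_equivalent_def fun_diff_def by blast
  obtain d where d: "exponent d = D" by (rule ex_exponent[of D]) (rule D)
  obtain e where e: "exponent e = (\<lambda>v. int (wt (Inl s1) (Inr v)))"
    by (rule ex_exponent[of "\<lambda>v. int (wt (Inl s1) (Inr v))"]) auto
  interpret L1: degree_zero_lattice "range (laplacian wt1)" by (rule degree_zero_lattice_laplacian)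
  interpret L2: degree_zero_lattice "range (laplacian wt2)" by (rule degree_zero_lattice_laplacian)
  interpret L: degree_zero_lattice "range (laplacian wt)" by (rule degree_zero_lattice_laplacian)
  have s1_row: "wt1 s1 v = 0" "outdeg wt1 s1 = 0" for v
    using sink absolute_sink_weight by (auto simp: absolute_sink_def)
  have sum_sum: "(\<Sum>x\<in>UNIV. g x) = (\<Sum>v\<in>UNIV. g (Inl v)) + (\<Sum>v\<in>UNIV. g (Inr v))" for g :: "'a + 'b \<Rightarrow> 'c::comm_monoid_add"
  proof -
    have "sum g (range Inl \<union> range Inr) = sum g (range Inl) + sum g (range Inr)"
      by (rule sum.union_disjoint) auto
    then show ?thesis by (simp add: UNIV_sum sum.reindex)
  qed
  have outdeg: "u \<noteq> s1 \<Longrightarrow> outdeg wt (Inl u) = outdeg wt1 u" "outdeg wt (Inr w) = outdeg wt2 w" for u w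
    by (simp_all add: outdeg_def sum_sum wt1 wt2 wt12 wt21)
  have laplacian_join: "laplacian wt (join f g) =
      join (laplacian wt1 f + (\<lambda>i. f s1 * W i)) (laplacian wt2 g - (\<lambda>i. f s1 * exponent e i))" for f g
  proof -
    have "(\<Sum>v\<in>UNIV. f v * (int (outdeg wt (Inl v)) * vertex_divisor v w - int (wt (Inl v) (Inl w))))
        = (\<Sum>v\<in>UNIV. f v * (int (outdeg wt1 v) * vertex_divisor v w - int (wt1 v w))
            + (if v = s1 then f s1 * W w else 0))" for w
      by (rule sum.cong)
        (auto simp: outdeg wt1 s1_row W vertex_divisor_def)
    then have "laplacian wt (join f g) (Inl w) = laplacian wt1 f w + f s1 * W w" for w
      by (simp add: laplacian_def sum_sum wt21 vertex_divisor_def sum.distrib)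
    moreover have "(\<Sum>v\<in>UNIV. f v * (int (outdeg wt (Inl v)) * vertex_divisor (Inl v) (Inr w) - int (wt (Inl v) (Inr w))))
        = (\<Sum>v\<in>UNIV. if v = s1 then - (f s1 * exponent e w) else 0)" for w
      by (rule sum.cong) (auto simp: wt12 e vertex_divisor_def)
    then have "laplacian wt (join f g) (Inr w) = laplacian wt2 g w - f s1 * exponent e w" for w
      by (simp add: laplacian_def sum_sum outdeg wt2 vertex_divisor_def)
    ultimately show ?thesis by (auto simp: fun_eq_iff split: sum.splits)
  qed
  have mem: "join x y \<in> range (laplacian wt) \<longleftrightarrow>
      (\<exists>k. x - (\<lambda>i. k * exponent d i) \<in> range (laplacian wt1) \<and> y + (\<lambda>i. k * exponent e i) \<in> range (laplacian wt2))"
    for x y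
  proof
    assume "join x y \<in> range (laplacian wt)"
    then obtain h where h: "join x y = laplacian wt h" by blast
    define f g where "f = h \<circ> Inl" and "g = h \<circ> Inr"
    have "h = join f g" by (auto simp: f_def g_def fun_eq_iff split: sum.splits)
    with h have "join x y = join (laplacian wt1 f + (\<lambda>i. f s1 * W i)) (laplacian wt2 g - (\<lambda>i. f s1 * exponent e i))"
      by (simp add: laplacian_join)
    then have x: "x = laplacian wt1 f + (\<lambda>i. f s1 * W i)" and y: "y = laplacian wt2 g - (\<lambda>i. f s1 * exponent e i)"
      by (simp_all add: case_sum_inject fun_eq_iff split: sum.splits)
    obtain p where p: "D - W = laplacian wt1 p" using D(2) by blast
    have "x - (\<lambda>i. f s1 * D i) = laplacian wt1 f - (\<lambda>i. f s1 * (D - W) i)"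
      by (simp add: x fun_eq_iff right_diff_distrib)
    also have "\<dots> = laplacian wt1 (f - (\<lambda>i. f s1 * p i))"
      by (simp add: p laplacian_diff laplacian_scale)
    finally have "x - (\<lambda>i. f s1 * exponent d i) \<in> range (laplacian wt1)" by (simp add: d)
    moreover have "y + (\<lambda>i. f s1 * exponent e i) = laplacian wt2 g" by (simp add: y)
    ultimately show "\<exists>k. x - (\<lambda>i. k * exponent d i) \<in> range (laplacian wt1) \<and> y + (\<lambda>i. k * exponent e i) \<in> range (laplacian wt2)"
      by blast
  next
    assume "\<exists>k. x - (\<lambda>i. k * exponent d i) \<in> range (laplacian wt1) \<and> y + (\<lambda>i. k * exponent e i) \<in> range (laplacian wt2)"
    then obtain k f g where f: "x - (\<lambda>i. k * D i) = laplacian wt1 f" and g: "y + (\<lambda>i. k * exponent e i) = laplacian wt2 g"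
      unfolding d by blast
    obtain p where p: "D - W = laplacian wt1 p" using D(2) by blast
    \<comment> \<open>The value at the absolute sink \<open>s1\<close> is free on the first graph, so it can be set to the
      number \<open>k\<close> of topplings of \<open>s1\<close> needed in the wiring.\<close>
    define f' where "f' = (f + (\<lambda>i. k * p i))(s1 := k)"
    have "laplacian wt1 f' = laplacian wt1 (f + (\<lambda>i. k * p i))"
      unfolding laplacian_def by (rule ext, rule sum.cong) (auto simp: f'_def s1_row)
    also have "\<dots> = laplacian wt1 f + (\<lambda>i. k * (D - W) i)"
      using laplacian_diff[of wt1 f "\<lambda>i. (- k) * p i"] laplacian_scale[of wt1 "- k" p]
      unfolding p by (simp add: fun_eq_iff plus_fun_def fun_diff_def)
    also have "\<dots> = x - (\<lambda>i. k * W i)"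
      unfolding f[symmetric] by (simp add: fun_eq_iff right_diff_distrib)
    finally have "x = laplacian wt1 f' + (\<lambda>i. f' s1 * W i)" by (simp add: f'_def)
    moreover have "y = laplacian wt2 g - (\<lambda>i. f' s1 * exponent e i)"
      unfolding g[symmetric] by (simp add: f'_def)
    ultimately have "join x y = laplacian wt (join f' g)" by (simp add: laplacian_join)
    then show "join x y \<in> range (laplacian wt)" by blast
  qed
  have e_nonzero: "e \<noteq> 0"
  proof
    assume "e = 0"
    then have "exponent e v = 0" for v by (simp add: exponent_def)
    then show False using nontrivial by (simp add: e)
  qed
  \<comment> \<open>The difference of \<open>d\<close> and \<open>e\<close> lies in the lattice, so the two have the same degree.\<close>
  have "d \<noteq> 0"
  proof
    assume "d = 0"
    then have "exponent d = (\<lambda>i. 0)" by (simp add: exponent_def)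
    moreover have "join (exponent d) (- exponent e) \<in> range (laplacian wt)"
      unfolding mem
      using L1.zero_mem L2.zero_mem by (intro exI[of _ 1]) (simp add: zero_fun_def fun_diff_def plus_fun_def)
    then have "degree (join (exponent d) (- exponent e)) = 0" by (rule L.degree_mem)
    then have "degree (exponent d) = degree (exponent e)"
      by (simp add: degree_def sum_sum sum_negf)
    ultimately show False using degree_exponent_pos[OF e_nonzero] by (simp add: degree_def)
  qed
  with e_nonzero mem have "glued_lattices (range (laplacian wt1)) (range (laplacian wt2)) (range (laplacian wt)) d e"
    by unfold_locales
  then show thesis by (rule that)
qed

section \<open>The sink as a parameter\<close>

lemma Var_power: "Var v ^ n = monomial (Poly_Mapping.single v n)"
proof (induction n)
  case 0
  show ?case by (simp add: monomial_def)
next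
  case (Suc n)
  have "Poly_Mapping.single v (Suc n) = Poly_Mapping.single v 1 + Poly_Mapping.single v n"
    by (simp flip: single_add)
  then have "monomial (Poly_Mapping.single v (Suc n)) = Var v * monomial (Poly_Mapping.single v n)"
    unfolding Var_def monomial_add[symmetric] by (simp only:)
  then show ?case by (simp only: power_Suc Suc)
qed

text \<open>
  Toppling \<open>v\<close> once identifies a power of its variable with a product that contains the variables of all
  its out-neighbours. So nilpotency spreads backwards along edges, starting from the sink.
\<close>

lemma Var_nilpotent_mod_sink:
  fixes wt :: "'v::finite \<Rightarrow> 'v \<Rightarrow> nat"
  assumes "sandpile_graph wt s"
  shows "\<exists>n. Var v ^ n \<in> toppling_ideal wt <+>\<^bsub>mpoly_ring\<^esub> PIdl\<^bsub>mpoly_ring\<^esub> (Var s)" (is "\<exists>n. _ \<in> ?J")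
proof -
  interpret degree_zero_lattice "range (laplacian wt)" by (rule degree_zero_lattice_laplacian)
  let ?I = "toppling_ideal wt"
  have I: "ideal ?I mpoly_ring" unfolding toppling_ideal_eq by (rule ideal_lattice_ideal)
  have J: "ideal ?J mpoly_ring" by (rule ideal_add_principal[OF I])
  have "(v, s) \<in> (edges wt)\<^sup>*" using assms by (simp add: sandpile_graph_def)
  then show ?thesis
  proof (induction rule: converse_rtrancl_induct)
    case base
    have "Var s ^ 1 - 1 * Var s \<in> ?I" using ideal_zero[OF I] by simp
    then show ?case unfolding in_add_principal_iff by blast
  next
    case (step v u)
    then obtain n where n: "Var u ^ n \<in> ?J" by blast
    obtain r where r: "exponent r = (\<lambda>i. int (wt v i))" by (rule ex_exponent[of "\<lambda>i. int (wt v i)"]) auto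
    let ?m = "Poly_Mapping.single v (outdeg wt v)"
    have "exponent ?m - exponent r = laplacian wt (vertex_divisor v)"
      by (auto simp: fun_eq_iff laplacian_vertex_divisor r)
        (auto simp: exponent_def lookup_single when_def vertex_divisor_def)
    then have diff: "monomial ?m - monomial r \<in> ?I"
      unfolding toppling_ideal_eq by (intro monomial_diff_mem) auto
    have "exponent r u > 0" using step.hyps(1) by (simp add: r edges_def)
    then have "Poly_Mapping.lookup r u \<noteq> 0" by (simp add: exponent_def)
    then have "monomial r ^ n = monomial (r - Poly_Mapping.single u 1) ^ n * Var u ^ n"
      using Var_dvd_monomial[of r u] by (simp add: power_mult_distrib)
    then have "monomial r ^ n \<in> ?J" using ideal_mult[OF J n] by metis
    moreover have "monomial ?m ^ n - monomial r ^ n \<in> ?J"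
    proof -
      have "monomial ?m ^ n - monomial r ^ n - 0 * Var s \<in> ?I"
        using ideal_mult'[OF I diff] by (simp add: power_diff_sumr2)
      then show ?thesis unfolding in_add_principal_iff by blast
    qed
    ultimately have "monomial ?m ^ n \<in> ?J" using ideal_add[OF J] by fastforce
    then show ?case by (metis Var_power power_mult)
  qed
qed

lemma eval_mpoly_mult_Var: "eval_mpoly z (p * Var v) = eval_mpoly z p * z v"
proof -
  have "eval_mpoly z (p * Var v) = linear_extension
      (\<lambda>k. (\<Prod>w\<in>UNIV. z w ^ Poly_Mapping.lookup k w) * eval_mpoly z (Var v)) p"
    unfolding eval_mpoly_eq Var_def linear_extension_times_monomial linear_extension_monomial
    by (simp add: lookup_add power_add prod.distrib)
  then show ?thesis
    by (simp add: eval_mpoly_Var) (simp add: eval_mpoly_eq linear_extension_def sum_distrib_right mult.assoc)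
qed

lemma sink_nonvanishing:
  fixes wt :: "'v::finite \<Rightarrow> 'v \<Rightarrow> nat"
  assumes "sandpile_graph wt s" and z: "z \<in> projective_zeros (toppling_ideal wt)"
  shows "eval_mpoly z (Var s) \<noteq> 0"
proof
  assume "eval_mpoly z (Var s) = 0"
  then have s: "z s = 0" by (simp add: eval_mpoly_Var)
  have "z v = 0" for v
  proof -
    obtain n h where nh: "Var v ^ n - h * Var s \<in> toppling_ideal wt"
      using Var_nilpotent_mod_sink[OF assms(1), of v] by (auto simp: in_add_principal_iff)
    have "eval_mpoly z (Var v ^ n) = z v ^ n"
    proof (induction n)
      case 0
      have "(1 :: 'v mpoly) = monomial 0" by (simp add: monomial_def)
      have "eval_mpoly z (1 :: 'v mpoly) = 1"
        unfolding \<open>1 = monomial 0\<close> eval_mpoly_monomial by simp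
      then show ?case by simp
    next
      case (Suc n)
      then show ?case by (simp only: power_Suc2 eval_mpoly_mult_Var)
    qed
    moreover have "eval_mpoly z (Var v ^ n - h * Var s) = 0"
      using z nh unfolding projective_zeros_def by blast
    then have "eval_mpoly z (Var v ^ n) = eval_mpoly z (h * Var s)"
      unfolding eval_mpoly_eq linear_extension_diff by simp
    ultimately show ?thesis by (simp add: eval_mpoly_mult_Var s)
  qed
  then show False using z by (simp add: projective_zeros_def)
qed

text \<open>
  Only the monomials whose exponents stay below the orders of nilpotency survive.
\<close>

lemma finite_codimension_if_Vars_nilpotent:
  fixes J :: "'v::finite mpoly set"
  assumes J: "ideal J mpoly_ring" and nil: "\<And>v. \<exists>n. Var v ^ n \<in> J"
  shows "\<exists>F. finite F \<and> (\<forall>p. \<exists>e\<in>mpoly.span F. p - e \<in> J)"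
proof -
  obtain n where n: "\<And>v. Var v ^ n v \<in> J" using nil by metis
  define B where "B = {m. \<forall>v. Poly_Mapping.lookup m v < n v}"
  let ?F = "monomial ` B"
  have "finite B"
  proof (rule finite_imageD)
    have "Poly_Mapping.lookup ` B \<subseteq> PiE UNIV (\<lambda>v. {..<n v})" by (auto simp: B_def)
    then show "finite (Poly_Mapping.lookup ` B)" by (rule finite_subset) (simp add: finite_PiE)
    show "inj_on Poly_Mapping.lookup B" by (rule inj_onI) (simp only: Poly_Mapping.lookup_inject)
  qed
  have monomial_case: "\<exists>e\<in>mpoly.span ?F. monomial m - e \<in> J" for m
  proof (cases "m \<in> B")
    case True
    then have "monomial m \<in> mpoly.span ?F" by (simp add: mpoly.span_base)
    then show ?thesis using ideal_zero[OF J] by (intro bexI[of _ "monomial m"]) simp_all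
  next
    case False
    then obtain v where "Poly_Mapping.lookup m v \<ge> n v" by (auto simp: B_def not_less)
    then have "m = (m - Poly_Mapping.single v (n v)) + Poly_Mapping.single v (n v)"
      by (rule split_off_variable)
    then have "monomial m = monomial (m - Poly_Mapping.single v (n v)) * Var v ^ n v"
      unfolding Var_power monomial_add[symmetric] by simp
    then have "monomial m \<in> J" using ideal_mult[OF J n] by metis
    then show ?thesis by (intro bexI[of _ 0]) (simp_all add: mpoly.span_zero)
  qed
  have "\<exists>e\<in>mpoly.span ?F. p - e \<in> J" for p
  proof (induction p rule: monomial_induct)
    case zero
    show ?case using ideal_zero[OF J] by (intro bexI[of _ 0]) (simp_all add: mpoly.span_zero)
  next
    case (monomial c m)
    obtain e where e: "e \<in> mpoly.span ?F" "monomial m - e \<in> J" using monomial_case by blast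
    have "scale c (monomial m) - scale c e \<in> J"
      using ideal_scale[OF J e(2)] by (simp add: mpoly.scale_right_diff_distrib)
    then show ?case using mpoly.span_scale[OF e(1)] by blast
  next
    case (add p q)
    then obtain e e' where e: "e \<in> mpoly.span ?F" "p - e \<in> J" and e': "e' \<in> mpoly.span ?F" "q - e' \<in> J"
      by blast
    have "(p + q) - (e + e') \<in> J"
      using ideal_add[OF J e(2) e'(2)] by (simp add: algebra_simps)
    then show ?case using mpoly.span_add[OF e(1) e'(1)] by blast
  qed
  then show ?thesis using \<open>finite B\<close> by blast
qed

section \<open>Wirings of Gorenstein sandpile graphs\<close>

text \<open>
  A linear form whose quotient is Artinian is regular and can be exchanged for any nonconstant monomial
  without changing the dimension of the socle. For a monomial the socle is a matter of counting maximal
  residual classes.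
\<close>

lemma gorenstein_unique_maximal:
  fixes wt :: "'v::finite \<Rightarrow> 'v \<Rightarrow> nat"
  assumes "gorenstein_sandpile_graph wt s" and "d \<noteq> 0"
  obtains u where "maximal_residual (range (laplacian wt)) (exponent d) u"
    and "\<And>u'. maximal_residual (range (laplacian wt)) (exponent d) u' \<Longrightarrow> u' - u \<in> range (laplacian wt)"
proof -
  interpret degree_zero_lattice "range (laplacian wt)" by (rule degree_zero_lattice_laplacian)
  let ?I = "lattice_ideal (range (laplacian wt))"
  obtain a where a: "linear_form a"
      "artinian_gorenstein (?I <+>\<^bsub>mpoly_ring\<^esub> PIdl\<^bsub>mpoly_ring\<^esub> a)"
    using assms(1) unfolding gorenstein_sandpile_graph_def toppling_ideal_eq by blast
  then obtain F where F: "finite F" "\<And>p. \<exists>e\<in>mpoly.span F. p - e \<in> ?I <+>\<^bsub>mpoly_ring\<^esub> PIdl\<^bsub>mpoly_ring\<^esub> a"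
      and socle: "one_dimensional_socle (?I <+>\<^bsub>mpoly_ring\<^esub> PIdl\<^bsub>mpoly_ring\<^esub> a)"
    unfolding artinian_gorenstein_iff[OF ideal_add_principal[OF ideal_lattice_ideal]] by blast
  have "one_dimensional_socle (?I <+>\<^bsub>mpoly_ring\<^esub> PIdl\<^bsub>mpoly_ring\<^esub> (monomial d))"
    by (rule one_dimensional_socle_transfer[OF ideal_lattice_ideal linear_form_irrelevant[OF a(1)]
          regular_if_finite_codimension[OF F] monomial_irrelevant[OF assms(2)] monomial_regular socle])
  then show thesis unfolding one_dimensional_socle_monomial_iff using that by blast
qed

theorem theorem8p31:
  fixes wt1 :: "'a::finite \<Rightarrow> 'a \<Rightarrow> nat" and s1 :: 'a
    and wt2 :: "'b::finite \<Rightarrow> 'b \<Rightarrow> nat" and s2 :: 'b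
    and wt :: "'a + 'b \<Rightarrow> 'a + 'b \<Rightarrow> nat"
  assumes "gorenstein_sandpile_graph wt1 s1" and "absolute_sink wt1 s1"
    and "gorenstein_sandpile_graph wt2 s2" and "absolute_sink wt2 s2"
    and "wiring wt1 s1 wt2 s2 wt"
  shows "gorenstein_sandpile_graph wt (Inr s2)"
proof -
  let ?L1 = "range (laplacian wt1)" and ?L2 = "range (laplacian wt2)" and ?L = "range (laplacian wt)"
  let ?J = "toppling_ideal wt <+>\<^bsub>mpoly_ring\<^esub> PIdl\<^bsub>mpoly_ring\<^esub> (Var (Inr s2))"
  have sandpile: "sandpile_graph wt (Inr s2)" using assms(5) by (simp add: wiring_def)
  obtain d e where "glued_lattices ?L1 ?L2 ?L d e"
    by (rule glued_lattices_wiring[OF assms(2,5)])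
  then interpret glued_lattices ?L1 ?L2 ?L d e .
  obtain u1 where u1: "maximal_residual ?L1 (exponent d) u1"
      "\<And>u. maximal_residual ?L1 (exponent d) u \<Longrightarrow> u - u1 \<in> ?L1"
    by (rule gorenstein_unique_maximal[OF assms(1) d_nonzero]) blast
  have s2_nonzero: "Poly_Mapping.single s2 1 \<noteq> (0 :: 'b \<Rightarrow>\<^sub>0 nat)" by (metis lookup_single_eq lookup_zero one_neq_zero)
  obtain u2 where u2: "maximal_residual ?L2 (exponent (Poly_Mapping.single s2 1)) u2"
      "\<And>u. maximal_residual ?L2 (exponent (Poly_Mapping.single s2 1)) u \<Longrightarrow> u - u2 \<in> ?L2"
    by (rule gorenstein_unique_maximal[OF assms(3) s2_nonzero]) blast
  have sink: "exponent (Poly_Mapping.single (Inr s2) 1) = join (0 :: 'a \<Rightarrow> int) (exponent (Poly_Mapping.single s2 1))"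
    by (simp only: exponent_single vertex_divisor_sum)
  have J: "ideal ?J mpoly_ring"
    unfolding toppling_ideal_eq by (rule ideal_add_principal[OF L.ideal_lattice_ideal])
  have "one_dimensional_socle ?J"
    unfolding toppling_ideal_eq Var_def L.one_dimensional_socle_monomial_iff sink
    using unique_maximal_residual[OF u1 u2] by blast
  moreover have "\<exists>F. finite F \<and> (\<forall>p. \<exists>e\<in>mpoly.span F. p - e \<in> ?J)"
    by (rule finite_codimension_if_Vars_nilpotent[OF J Var_nilpotent_mod_sink[OF sandpile]])
  ultimately have "artinian_gorenstein ?J" unfolding artinian_gorenstein_iff[OF J] by blast
  then show ?thesis
    unfolding gorenstein_sandpile_graph_def
    using sandpile linear_form_Var sink_nonvanishing[OF sandpile] by blast
qed

end
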